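(* Let $\mu,\nu>0$ with $\mu+\nu=1$ (so that $\nu<1$). For each integer $N\ge1$ let $C_N$ be an integer with $1\le C_N\le N$, and let $(X_N(t))_{t\ge0}$ be the Engset process with $N$ sources, capacity $C_N$ and parameters $\nu,\mu$, started at $X_N(0)=0$. Let $T_{C_N}^{X_N}=\inf\{s\ge0:X_N(s)=C_N\}$. If $C_N=\nu N+\delta\sqrt{N}+o(\sqrt{N})$ as $N\to+\infty$ for some $\delta\in\mathbb{R}$, then the sequence of random variables $$\left(T_{C_N}^{X_N}-\frac{\log N}{2}\right)$$ converges in distribution, as $N\to+\infty$, to a random variable $Z$ on $\mathbb{R}$ whose Laplace transform at every $\alpha>0$ is given by $$\mathbb{E}\left(e^{-\alpha Z}\right)=\Gamma(\alpha)\left/\int_0^{+\infty}\exp\left(u\frac{\delta}{\nu}-\frac{u^2}{2}\,\frac{1-\nu}{\nu}\right)u^{\alpha-1}\,du\right..$$ Moreover, if $\delta=0$, then the random variable $Z-\frac12\log\left(\frac{\nu}{1-\nu}\right)$ has the density $$x\mapsto\sqrt{\frac{2}{\pi}}\,\exp\left(-x-\frac{e^{-2x}}{2}\right)$$ on $\mathbb{R}$.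
   Context: The Engset process $(X_N(t))_{t\ge0}$ with $N$ sources, capacity $C_N$ ($1\le C_N\le N$) and parameters $\nu,\mu>0$ is the continuous-time (right-continuous) birth and death Markov process on $\{0,1,\ldots,C_N\}$ with transition rates $q(x,x-1)=\mu x$ for $0\le x\le C_N$ and $q(x,x+1)=\nu(N-x)$ for $0\le x<C_N$ (no upward jump from $C_N$). The time scale is normalized so that $\mu+\nu=1$. $\Gamma(\alpha)=\int_0^{+\infty}e^{-u}u^{\alpha-1}\,du$ for $\alpha>0$ is the Gamma function. *)

theory Defs
  imports "HOL-Probability.Probability" "HOL-Library.Landau_Symbols"
begin

text \<open>
  Transition function of a time-homogeneous continuous-time Markov chain on a finite state
  space \<open>S\<close>. Only the off-diagonal jump rates are prescribed; since \<open>S\<close> is finite and the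
  rows sum to one, the derivative at \<open>0\<close> of a diagonal entry is then minus the total jump rate.
\<close>

definition transition_function ::
  "'s set \<Rightarrow> ('s \<Rightarrow> 's \<Rightarrow> real) \<Rightarrow> (real \<Rightarrow> 's \<Rightarrow> 's \<Rightarrow> real) \<Rightarrow> bool" where
  "transition_function S q P \<longleftrightarrow>
     (\<forall>t\<ge>0. \<forall>x\<in>S. (\<forall>y\<in>S. 0 \<le> P t x y) \<and> (\<Sum>y\<in>S. P t x y) = 1) \<and>
     (\<forall>x\<in>S. \<forall>y\<in>S. P 0 x y = (if x = y then 1 else 0)) \<and>
     (\<forall>s\<ge>0. \<forall>t\<ge>0. \<forall>x\<in>S. \<forall>y\<in>S. P (s + t) x y = (\<Sum>z\<in>S. P s x z * P t z y)) \<and>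
     (\<forall>x\<in>S. \<forall>y\<in>S. x \<noteq> y \<longrightarrow> ((\<lambda>t. P t x y) has_real_derivative q x y) (at_right 0))"

text \<open>
  Right-continuous Markov process \<open>(X t)\<close>, \<open>t \<ge> 0\<close>, on a finite set \<open>S\<close> of naturals with jump
  rates \<open>q\<close>. The last conjunct is the Markov property
  \<open>P(X(t (n+1)) = x (n+1) | X(t 0) = x 0, ..., X(t n) = x n)
    = P (t (n+1) - t n) (x n) (x (n+1))\<close>,
  multiplied out to avoid conditioning on null events. The initial law is left free.
\<close>

definition markov_jump_process ::
  "'a measure \<Rightarrow> nat set \<Rightarrow> (nat \<Rightarrow> nat \<Rightarrow> real) \<Rightarrow> (real \<Rightarrow> 'a \<Rightarrow> nat) \<Rightarrow> bool" where
  "markov_jump_process M S q X \<longleftrightarrow>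
     prob_space M \<and> finite S \<and>
     (\<forall>t\<ge>0. X t \<in> measurable M (count_space UNIV)) \<and>
     (\<forall>\<omega>\<in>space M. \<forall>t\<ge>0. X t \<omega> \<in> S \<and> continuous (at_right t) (\<lambda>s. X s \<omega>)) \<and>
     (\<exists>P. transition_function S q P \<and>
       (\<forall>(n::nat) (t :: nat \<Rightarrow> real) (x :: nat \<Rightarrow> nat).
          0 \<le> t 0 \<longrightarrow> (\<forall>i\<le>n. t i < t (Suc i)) \<longrightarrow> (\<forall>i\<le>Suc n. x i \<in> S) \<longrightarrow>
          measure M {\<omega> \<in> space M. \<forall>i\<le>Suc n. X (t i) \<omega> = x i} =
          measure M {\<omega> \<in> space M. \<forall>i\<le>n. X (t i) \<omega> = x i} *
            P (t (Suc n) - t n) (x n) (x (Suc n))))"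

definition engset_rate :: "nat \<Rightarrow> nat \<Rightarrow> real \<Rightarrow> real \<Rightarrow> nat \<Rightarrow> nat \<Rightarrow> real" where
  "engset_rate N C \<nu> \<mu> x y =
     (if x = y + 1 \<and> x \<le> C then \<mu> * real x
      else if y = x + 1 \<and> x < C then \<nu> * (real N - real x)
      else 0)"

definition engset_process ::
  "'a measure \<Rightarrow> nat \<Rightarrow> nat \<Rightarrow> real \<Rightarrow> real \<Rightarrow> (real \<Rightarrow> 'a \<Rightarrow> nat) \<Rightarrow> bool" where
  "engset_process M N C \<nu> \<mu> X \<longleftrightarrow> markov_jump_process M {0..C} (engset_rate N C \<nu> \<mu>) X"

text \<open>The infimum is taken in the extended reals, so it is \<open>\<infinity>\<close> if the state is never reached.\<close>

definition hitting_time :: "(real \<Rightarrow> 'a \<Rightarrow> 's) \<Rightarrow> 's \<Rightarrow> 'a \<Rightarrow> ereal" where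
  "hitting_time X a \<omega> = (INF s\<in>{s. 0 \<le> s \<and> X s \<omega> = a}. ereal s)"

end

(*
  Write rho = mu / nu. For every alpha > 0 the function
    f x = integral over 0 < u < 1 of (1 + rho u)^x (1 - u)^(N - x) u^(alpha - 1)
  satisfies L f = alpha f below C for the Engset generator L, so that E exp(-alpha T) = f 0 / f C;
  this is proved by sampling the process on a grid of mesh 1/m and letting m grow. Rescaling u by N
  in f 0 and by sqrt N in f C, dominated convergence gives N^alpha f 0 --> Gamma alpha and
  N^(alpha/2) f C --> the Gaussian integral of the statement. The transforms of the centred hitting
  times thus converge at every alpha > 0. Convergence in law follows by tightness together with
  uniqueness: exp(-Z) has moments that grow slowly enough to determine its characteristic function.
  For delta = 0 these moments are, up to scaling, those of the absolute value of a standard normal variable.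
*)

theory Submission
  imports Defs "HOL-Real_Asymp.Real_Asymp"
begin

section \<open>Hitting times of right-continuous Markov chains\<close>

text \<open>The eigenfunctions come from independent sources. For one on/off source, the vector with
  value \<rho> when on and -1 when off is an eigenvector of its generator for -(\<mu> + \<nu>) = -1,
  and 1 + \<rho> u and 1 - u are the values of 1 plus u times that vector. Multiplying over the N
  sources and integrating against a power of u trades the eigenvalue -1 for any \<alpha> > 0. The
  capacity does not interfere, because it changes the rates only in the state C, where the process
  is stopped. Stopping is the first obstacle: the process is given by its laws at fixed times and by
  right-continuous paths. On the grid a local error o(h) per step, discounted at rate \<alpha>, adds
  up to o(1). The second obstacle is that the transforms converge only for \<alpha> > 0 and not
  around 0. Bounded transforms keep mass from escaping to minus infinity, but a loss at plus
  infinity is detected only by the behaviour of the limiting transform as \<alpha> decreases to 0.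
  The same issue arises for a single N, where finiteness of the hitting time has to be
  proved.\<close>

lemma right_continuous_nat_locally_constant:
  fixes x :: "real \<Rightarrow> nat"
  assumes "continuous (at_right t) x"
  obtains e where "e > 0" "\<And>s. t \<le> s \<Longrightarrow> s < t + e \<Longrightarrow> x s = x t"
proof -
  have "(x \<longlongrightarrow> x t) (at_right t)"
    using assms by (simp add: continuous_within)
  then have "eventually (\<lambda>s. x s = x t) (at_right t)"
    by (simp add: tendsto_discrete)
  then obtain b where b: "b > t" "\<And>s. t < s \<Longrightarrow> s < b \<Longrightarrow> x s = x t"
    by (auto simp: eventually_at_right_field)
  show ?thesis
  proof (rule that[of "b - t"])
    fix s assume "t \<le> s" "s < t + (b - t)"
    then show "x s = x t" using b by (cases "s = t") auto
  qed (use b in simp)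
qed

text \<open>Visits to \<open>a\<close> occur in every right neighbourhood of the infimum, and the
  path is constant on one such neighbourhood including its left end. So the infimum is itself a
  visiting time.\<close>

lemma hitting_time_attained:
  fixes X :: "real \<Rightarrow> 'a \<Rightarrow> nat"
  assumes cont: "\<And>t. t \<ge> 0 \<Longrightarrow> continuous (at_right t) (\<lambda>s. X s \<omega>)"
    and fin: "hitting_time X a \<omega> < \<infinity>"
  obtains T where "T \<ge> 0" "hitting_time X a \<omega> = ereal T" "X T \<omega> = a"
    "\<And>s. 0 \<le> s \<Longrightarrow> s < T \<Longrightarrow> X s \<omega> \<noteq> a"
proof -
  define A where "A = {s. 0 \<le> s \<and> X s \<omega> = a}"
  have ne: "A \<noteq> {}"
    using fin unfolding hitting_time_def A_def[symmetric] by (intro notI) (simp add: top_ereal_def)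
  have bdd: "bdd_below A" unfolding A_def by (auto intro!: bdd_belowI[of _ 0])
  define T where "T = Inf A"
  have T0: "T \<ge> 0" unfolding T_def using ne by (intro cInf_greatest) (auto simp: A_def)
  have low: "T \<le> s" if "s \<in> A" for s unfolding T_def using that bdd by (rule cInf_lower)
  obtain e where e: "e > 0" "\<And>s. T \<le> s \<Longrightarrow> s < T + e \<Longrightarrow> X s \<omega> = X T \<omega>"
    using right_continuous_nat_locally_constant[OF cont[OF T0]] by blast
  have "\<exists>s\<in>A. s < T + e"
    using cInf_lessD[OF ne, of "T + e"] e(1) unfolding T_def by auto
  then obtain s where s: "s \<in> A" "s < T + e" by blast
  have XT: "X T \<omega> = a" using e(2)[OF low[OF s(1)] s(2)] s(1) by (simp add: A_def)
  have "hitting_time X a \<omega> = ereal T"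
    unfolding hitting_time_def A_def[symmetric]
  proof (rule antisym)
    show "(INF s\<in>A. ereal s) \<le> ereal T"
      using XT T0 by (intro INF_lower) (auto simp: A_def)
    show "ereal T \<le> (INF s\<in>A. ereal s)"
      using low by (intro INF_greatest) auto
  qed
  moreover have "X s \<omega> \<noteq> a" if "0 \<le> s" "s < T" for s
    using low[of s] that by (auto simp: A_def)
  ultimately show ?thesis using that T0 XT by blast
qed

lemma hitting_time_le:
  "X s \<omega> = a \<Longrightarrow> 0 \<le> s \<Longrightarrow> hitting_time X a \<omega> \<le> ereal s"
  unfolding hitting_time_def by (rule INF_lower) simp

text \<open>The first visit lasts for a positive time, so a visit before \<open>y\<close> is also
  seen at a rational time before \<open>y\<close>. This makes the union over times
  countable.\<close>

lemma borel_measurable_hitting_time: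
  fixes X :: "real \<Rightarrow> 'a \<Rightarrow> nat"
  assumes meas: "\<And>t. t \<ge> 0 \<Longrightarrow> X t \<in> measurable M (count_space UNIV)"
    and cont: "\<And>\<omega> t. \<omega> \<in> space M \<Longrightarrow> t \<ge> 0 \<Longrightarrow> continuous (at_right t) (\<lambda>s. X s \<omega>)"
  shows "hitting_time X a \<in> borel_measurable M"
proof (rule borel_measurableI_less)
  fix y :: ereal
  have "{\<omega> \<in> space M. hitting_time X a \<omega> < y} =
     (\<Union>q\<in>{q\<in>\<rat>. 0 \<le> q \<and> ereal q < y}. {\<omega> \<in> space M. X q \<omega> = a})" (is "?L = ?R")
  proof (intro equalityI subsetI)
    fix \<omega> assume "\<omega> \<in> ?R"
    then show "\<omega> \<in> ?L" using hitting_time_le[of X _ \<omega> a] by (auto intro: le_less_trans)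
  next
    fix \<omega> assume om: "\<omega> \<in> ?L"
    then have sp: "\<omega> \<in> space M" and lt: "hitting_time X a \<omega> < y" by auto
    have "hitting_time X a \<omega> < \<infinity>" using lt less_le_trans by (metis ereal_infty_less(1) less_ereal.simps(2) neq_iff order_less_trans)
    then obtain T where T: "T \<ge> 0" "hitting_time X a \<omega> = ereal T" "X T \<omega> = a"
      using hitting_time_attained[of X \<omega> a] cont[OF sp] by metis
    obtain e where e: "e > 0" "\<And>s. T \<le> s \<Longrightarrow> s < T + e \<Longrightarrow> X s \<omega> = X T \<omega>"
      using right_continuous_nat_locally_constant[OF cont[OF sp T(1)]] by blast
    obtain z where z: "T < z" "ereal z < y"
      using lt T(2) ereal_dense3 ereal_dense2 by (metis ereal_less_eq(3) less_ereal.simps(1) linorder_not_le)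
    obtain q where q: "q \<in> \<rat>" "T < q" "q < min z (T + e)"
      using Rats_dense_in_real[of T "min z (T + e)"] z e by auto
    have "ereal q < y" using q z by (meson ereal_less_eq(3) less_imp_le min_less_iff_conj order_le_less_trans)
    with q T e(2)[of q] sp show "\<omega> \<in> ?R" by auto
  qed
  moreover have "?R \<in> sets M"
  proof (rule sets.countable_UN'')
    show "countable {q\<in>\<rat>. 0 \<le> q \<and> ereal q < y}"
      using countable_rat by (rule countable_subset[rotated]) auto
    fix q assume "q \<in> {q\<in>\<rat>. 0 \<le> q \<and> ereal q < y}"
    then have [measurable]: "X q \<in> measurable M (count_space UNIV)" using meas by auto
    show "{\<omega> \<in> space M. X q \<omega> = a} \<in> sets M" by measurable
  qed
  ultimately show "{\<omega> \<in> space M. hitting_time X a \<omega> < y} \<in> sets M" by simp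
qed

section \<open>Grid sampling and discounted absorption\<close>

text \<open>The defining Markov property concerns a completely specified past. The event that the
  past stays in \<open>B\<close> splits into finitely many words over \<open>B\<close>, and each
  word contributes the same factor \<open>P\<close>, which depends on the last two states
  only.\<close>

lemma markov_jump_process_history:
  assumes M: "prob_space M" and fin: "finite S"
    and meas: "\<And>t. t \<ge> 0 \<Longrightarrow> X t \<in> measurable M (count_space UNIV)"
    and markov: "\<And>(n::nat) (t :: nat \<Rightarrow> real) (x :: nat \<Rightarrow> nat).
          0 \<le> t 0 \<Longrightarrow> (\<forall>i\<le>n. t i < t (Suc i)) \<Longrightarrow> (\<forall>i\<le>Suc n. x i \<in> S) \<Longrightarrow>
          measure M {\<omega> \<in> space M. \<forall>i\<le>Suc n. X (t i) \<omega> = x i} =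
          measure M {\<omega> \<in> space M. \<forall>i\<le>n. X (t i) \<omega> = x i} *
            P (t (Suc n) - t n) (x n) (x (Suc n))"
    and t: "0 \<le> t 0" "\<And>i. t i < t (Suc i)" and B: "B \<subseteq> S" and xy: "x \<in> S" "y \<in> S"
  shows "measure M {\<omega> \<in> space M. (\<forall>i<n. X (t i) \<omega> \<in> B) \<and> X (t n) \<omega> = x \<and> X (t (Suc n)) \<omega> = y} =
         measure M {\<omega> \<in> space M. (\<forall>i<n. X (t i) \<omega> \<in> B) \<and> X (t n) \<omega> = x} *
           P (t (Suc n) - t n) x y"
proof -
  interpret prob_space M by fact
  have mono: "strict_mono t" using t(2) by (simp add: strict_mono_Suc_iff)
  then have t0: "t i \<ge> 0" for i
    using t(1) strict_mono_less_eq[OF mono, of 0 i] by linarith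
  note [measurable] = meas[OF t0]
  let ?G = "PiE {..<n} (\<lambda>_. B)"
  \<comment> \<open>A word \<open>g\<close> of length \<open>n\<close> is continued by
    \<open>x\<close> at position \<open>n\<close> and by \<open>y\<close> afterwards, so one
    function describes both the event up to \<open>n\<close> and the event up to
    \<open>Suc n\<close>.\<close>
  define ext where "ext g i = (if i < n then g i else if i = n then x else y)" for g :: "nat \<Rightarrow> nat" and i
  have finG: "finite ?G" using fin B by (intro finite_PiE) (auto intro: finite_subset)
  have eq1: "{\<omega> \<in> space M. (\<forall>i<n. X (t i) \<omega> \<in> B) \<and> X (t n) \<omega> = x \<and> X (t (Suc n)) \<omega> = y} =
    (\<Union>g\<in>?G. {\<omega> \<in> space M. \<forall>i\<le>Suc n. X (t i) \<omega> = ext g i})" (is "?L = ?R")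
  proof (intro equalityI subsetI)
    fix \<omega> assume om: "\<omega> \<in> ?L"
    show "\<omega> \<in> ?R"
      using om by (intro UN_I[of "restrict (\<lambda>i. X (t i) \<omega>) {..<n}"]) (auto simp: ext_def le_Suc_eq)
  next
    fix \<omega> assume "\<omega> \<in> ?R"
    then obtain g where g: "g \<in> ?G" "\<omega> \<in> space M" "\<And>i. i \<le> Suc n \<Longrightarrow> X (t i) \<omega> = ext g i" by auto
    show "\<omega> \<in> ?L"
      using g(3)[of n] g(3)[of "Suc n"] g(1,2) by (auto simp: g(3) ext_def PiE_iff)
  qed
  have eq2: "{\<omega> \<in> space M. (\<forall>i<n. X (t i) \<omega> \<in> B) \<and> X (t n) \<omega> = x} =
    (\<Union>g\<in>?G. {\<omega> \<in> space M. \<forall>i\<le>n. X (t i) \<omega> = ext g i})" (is "?L = ?R")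
  proof (intro equalityI subsetI)
    fix \<omega> assume om: "\<omega> \<in> ?L"
    show "\<omega> \<in> ?R"
      using om by (intro UN_I[of "restrict (\<lambda>i. X (t i) \<omega>) {..<n}"]) (auto simp: ext_def)
  next
    fix \<omega> assume "\<omega> \<in> ?R"
    then obtain g where g: "g \<in> ?G" "\<omega> \<in> space M" "\<And>i. i \<le> n \<Longrightarrow> X (t i) \<omega> = ext g i" by auto
    show "\<omega> \<in> ?L"
      using g(3)[of n] g(1,2) by (auto simp: g(3) ext_def PiE_iff)
  qed
  have dj: "disjoint_family_on (\<lambda>g. {\<omega> \<in> space M. \<forall>i\<le>m. X (t i) \<omega> = ext g i}) ?G" if "m \<ge> n" for m
  unfolding disjoint_family_on_def
  proof (intro ballI impI)
    fix g g' assume g: "g \<in> ?G" "g' \<in> ?G" "g \<noteq> g'"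
    then obtain i where i: "i < n" "g i \<noteq> g' i" by (metis PiE_ext lessThan_iff)
    then have "i \<le> m" "ext g i \<noteq> ext g' i" using that by (auto simp: ext_def)
    then show "{\<omega> \<in> space M. \<forall>i\<le>m. X (t i) \<omega> = ext g i} \<inter> {\<omega> \<in> space M. \<forall>i\<le>m. X (t i) \<omega> = ext g' i} = {}"
      by force
  qed
  have sets: "(\<lambda>g. {\<omega> \<in> space M. \<forall>i\<le>m. X (t i) \<omega> = ext g i}) ` ?G \<subseteq> sets M" for m
    by (intro image_subsetI) measurable
  have extS: "\<forall>i\<le>Suc n. ext g i \<in> S" if "g \<in> ?G" for g
    using that xy B by (auto simp: ext_def PiE_iff)
  have "measure M {\<omega> \<in> space M. (\<forall>i<n. X (t i) \<omega> \<in> B) \<and> X (t n) \<omega> = x \<and> X (t (Suc n)) \<omega> = y} =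
     (\<Sum>g\<in>?G. measure M {\<omega> \<in> space M. \<forall>i\<le>Suc n. X (t i) \<omega> = ext g i})"
    unfolding eq1 by (rule finite_measure_finite_Union[OF finG sets dj]) simp_all
  also have "\<dots> = (\<Sum>g\<in>?G. measure M {\<omega> \<in> space M. \<forall>i\<le>n. X (t i) \<omega> = ext g i} * P (t (Suc n) - t n) x y)"
  proof (rule sum.cong)
    fix g assume "g \<in> ?G"
    from markov[where n = n and t = t and x = "ext g", OF t(1) _ extS[OF this]] t(2)
    show "measure M {\<omega> \<in> space M. \<forall>i\<le>Suc n. X (t i) \<omega> = ext g i} =
      measure M {\<omega> \<in> space M. \<forall>i\<le>n. X (t i) \<omega> = ext g i} * P (t (Suc n) - t n) x y"
      by (auto simp: ext_def)
  qed simp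
  also have "\<dots> = measure M {\<omega> \<in> space M. (\<forall>i<n. X (t i) \<omega> \<in> B) \<and> X (t n) \<omega> = x} * P (t (Suc n) - t n) x y"
    unfolding eq2 sum_distrib_right[symmetric]
    by (subst finite_measure_finite_Union[OF finG sets dj]) simp_all
  finally show ?thesis .
qed

text \<open>Derivatives are prescribed off the diagonal only. The row sum 1 eliminates
  \<open>P h x x\<close>; the derivative at 0 of the one-step defect is then the generator applied
  to \<open>f\<close> minus \<open>\<alpha> * f x\<close>, which is 0. The defect is therefore
  o(h).\<close>

lemma transition_function_eigenvector:
  assumes P: "transition_function S q P" and fin: "finite S" and x: "x \<in> S"
    and eig: "(\<Sum>y\<in>S - {x}. q x y * (f y - f x)) = \<alpha> * f x"
  shows "((\<lambda>h. ((\<Sum>y\<in>S. P h x y * f y) - exp (\<alpha> * h) * f x) / h) \<longlongrightarrow> 0) (at_right 0)"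
proof -
  define D where "D h = f x + (\<Sum>y\<in>S - {x}. P h x y * (f y - f x)) - exp (\<alpha> * h) * f x" for h
  have D: "(\<Sum>y\<in>S. P h x y * f y) - exp (\<alpha> * h) * f x = D h" if "h \<ge> 0" for h
  proof -
    have "(\<Sum>y\<in>S. P h x y) = 1" using P that x by (auto simp: transition_function_def)
    then have "(\<Sum>y\<in>S. P h x y * f y) = f x + (\<Sum>y\<in>S. P h x y * (f y - f x))"
      by (simp add: algebra_simps sum_subtractf flip: sum_distrib_left)
    then show ?thesis using fin x by (simp add: D_def sum.remove)
  qed
  have "((\<lambda>t. P t x y) has_real_derivative q x y) (at_right 0)" if "y \<in> S - {x}" for y
    using P that x by (auto simp: transition_function_def)
  then have "(D has_real_derivative (\<Sum>y\<in>S - {x}. q x y * (f y - f x)) - \<alpha> * exp (\<alpha> * 0) * f x) (at_right 0)"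
    unfolding D_def by (auto intro!: derivative_eq_intros)
  then have "(D has_real_derivative 0) (at_right 0)" using eig by simp
  moreover have "D 0 = 0"
    using P x by (subst D[symmetric]) (auto simp: transition_function_def fin if_distrib[of "\<lambda>z. z * _"] cong: if_cong)
  ultimately have "((\<lambda>h. D h / h) \<longlongrightarrow> 0) (at_right 0)"
    by (simp add: has_field_derivative_iff)
  then show ?thesis
    by (rule Lim_transform_eventually) (auto simp: eventually_at_right_field D intro!: exI[of _ 1])
qed

text \<open>Read \<open>a k x\<close> as the mass of chains that avoid \<open>c\<close> before step
  \<open>k\<close> and are in \<open>x\<close> at step \<open>k\<close>; then \<open>a k c\<close>
  is the mass of a first visit at step \<open>k\<close>. After discounting, the one-step relation
  telescopes up to the defects \<open>E k\<close>. These sum geometrically to at most r / (exp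
  (\<alpha> h) - 1), so a defect r = o(h) is small enough.\<close>

lemma discounted_absorption_estimate:
  fixes a :: "nat \<Rightarrow> 's \<Rightarrow> real" and p :: "'s \<Rightarrow> 's \<Rightarrow> real"
  assumes fin: "finite S" and c: "c \<in> S"
    and step: "\<And>k y. y \<in> S \<Longrightarrow> a (Suc k) y = (\<Sum>x\<in>S - {c}. a k x * p x y)"
    and nonneg: "\<And>k x. 0 \<le> a k x" and mass: "\<And>k. (\<Sum>x\<in>S. a k x) \<le> 1"
    and err: "\<And>x. x \<in> S - {c} \<Longrightarrow> \<bar>(\<Sum>y\<in>S. p x y * f y) - exp (\<alpha> * h) * f x\<bar> \<le> r"
    and r: "r \<ge> 0" and pos: "\<alpha> > 0" "h > 0"
  shows "\<bar>(\<Sum>k\<le>n. exp (- \<alpha> * h * real k) * a k c) * f c +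
      exp (- \<alpha> * h * real n) * (\<Sum>x\<in>S - {c}. a n x * f x) - (\<Sum>x\<in>S. a 0 x * f x)\<bar> \<le> r / (\<alpha> * h)"
proof -
  define q where "q = exp (- \<alpha> * h)"
  have q: "0 < q" "q < 1" using pos by (auto simp: q_def)
  have qk: "exp (- \<alpha> * h * real k) = q ^ k" for k
    by (simp add: q_def mult.commute flip: exp_of_nat_mult)
  define A where "A k = (\<Sum>x\<in>S - {c}. a k x * f x)" for k
  define E where "E k = (\<Sum>x\<in>S - {c}. a k x * ((\<Sum>y\<in>S. p x y * f y) - exp (\<alpha> * h) * f x))" for k
  have E: "\<bar>E k\<bar> \<le> r" for k
  proof -
    have "\<bar>E k\<bar> \<le> (\<Sum>x\<in>S - {c}. \<bar>a k x * ((\<Sum>y\<in>S. p x y * f y) - exp (\<alpha> * h) * f x)\<bar>)"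
      unfolding E_def by (rule sum_abs)
    also have "\<dots> \<le> (\<Sum>x\<in>S - {c}. a k x * r)"
      using err nonneg by (intro sum_mono) (auto simp: abs_mult intro!: mult_left_mono)
    also have "\<dots> = (\<Sum>x\<in>S - {c}. a k x) * r" by (simp add: sum_distrib_right)
    also have "(\<Sum>x\<in>S - {c}. a k x) \<le> (\<Sum>x\<in>S. a k x)" using fin nonneg by (intro sum_mono2) auto
    also have "\<dots> \<le> 1" by (rule mass)
    finally show ?thesis using r by (simp add: mult_right_mono)
  qed
  have rec: "A (Suc k) + a (Suc k) c * f c = exp (\<alpha> * h) * A k + E k" for k
  proof -
    have "A (Suc k) + a (Suc k) c * f c = (\<Sum>y\<in>S. a (Suc k) y * f y)"
      unfolding A_def using fin c by (simp add: sum.remove[of S c])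
    also have "\<dots> = (\<Sum>y\<in>S. \<Sum>x\<in>S - {c}. a k x * p x y * f y)"
      by (simp add: step sum_distrib_right)
    also have "\<dots> = (\<Sum>x\<in>S - {c}. a k x * (\<Sum>y\<in>S. p x y * f y))"
      by (subst sum.swap) (simp add: sum_distrib_left mult.assoc)
    also have "\<dots> = exp (\<alpha> * h) * A k + E k"
      by (simp add: A_def E_def sum_distrib_left sum.distrib[symmetric] algebra_simps)
    finally show ?thesis .
  qed
  have qe: "q * exp (\<alpha> * h) = 1" by (simp add: q_def flip: exp_add)
  have "(\<Sum>k\<le>n. q ^ k * a k c) * f c + q ^ n * A n - (\<Sum>x\<in>S. a 0 x * f x) = (\<Sum>k<n. q ^ Suc k * E k)"
  proof (induction n)
    case 0
    then show ?case using fin c by (simp add: A_def sum.remove[of S c])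
  next
    case (Suc n)
    have "q ^ Suc n * (A (Suc n) + a (Suc n) c * f c) = q ^ n * (q * exp (\<alpha> * h)) * A n + q ^ Suc n * E n"
      unfolding rec by (simp add: algebra_simps)
    with Suc show ?case unfolding qe by (simp add: algebra_simps)
  qed
  moreover have "\<bar>\<Sum>k<n. q ^ Suc k * E k\<bar> \<le> r / (\<alpha> * h)"
  proof -
    have "\<bar>\<Sum>k<n. q ^ Suc k * E k\<bar> \<le> (\<Sum>k<n. q ^ Suc k * r)"
      using q E by (intro order.trans[OF sum_abs] sum_mono) (auto simp: abs_mult intro!: mult_left_mono)
    also have "\<dots> = q * r * (\<Sum>k<n. q ^ k)" by (simp add: sum_distrib_left sum_distrib_right mult_ac)
    also have "(\<Sum>k<n. q ^ k) = (1 - q ^ n) / (1 - q)" using q by (simp add: sum_gp_strict)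
    also have "q * r * ((1 - q ^ n) / (1 - q)) \<le> q * r * (1 / (1 - q))"
      using q r by (intro mult_left_mono divide_right_mono) auto
    also have "\<dots> = r / (exp (\<alpha> * h) - 1)"
      using q pos by (simp add: q_def exp_minus field_simps)
    also have "\<dots> \<le> r / (\<alpha> * h)"
    proof (rule frac_le)
      show "\<alpha> * h \<le> exp (\<alpha> * h) - 1" using exp_ge_add_one_self[of "\<alpha> * h"] by linarith
    qed (use r pos in simp_all)
    finally show ?thesis .
  qed
  ultimately show ?thesis unfolding qk A_def by metis
qed

text \<open>This is optional stopping of exp (- \<alpha> t) f (X t) at the hitting time, obtained as
  a limit of the grid estimate. The case distinction in the integrand matters:
  \<open>real_of_ereal \<infinity>\<close> is 0, so without it a path that never reaches
  \<open>c\<close> would contribute 1 instead of 0.\<close>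

lemma laplace_hitting_time_eigenvector:
  fixes X :: "real \<Rightarrow> 'a \<Rightarrow> nat"
  assumes mjp: "markov_jump_process M S q X" and c: "c \<in> S" and \<alpha>: "\<alpha> > 0"
    and eig: "\<And>x. x \<in> S - {c} \<Longrightarrow> (\<Sum>y\<in>S - {x}. q x y * (f y - f x)) = \<alpha> * f x"
  shows "(LINT \<omega>|M. (if hitting_time X c \<omega> < \<infinity> then exp (- \<alpha> * real_of_ereal (hitting_time X c \<omega>)) else 0)) * f c
       = (LINT \<omega>|M. f (X 0 \<omega>))"
proof -
  from mjp have M: "prob_space M" and fin: "finite S"
    and meas: "\<And>t. t \<ge> 0 \<Longrightarrow> X t \<in> measurable M (count_space UNIV)"
    and inS: "\<And>\<omega> t. \<omega> \<in> space M \<Longrightarrow> t \<ge> 0 \<Longrightarrow> X t \<omega> \<in> S"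
    and cont: "\<And>\<omega> t. \<omega> \<in> space M \<Longrightarrow> t \<ge> 0 \<Longrightarrow> continuous (at_right t) (\<lambda>s. X s \<omega>)"
    unfolding markov_jump_process_def by auto
  from mjp obtain P where P: "transition_function S q P" and
    markov: "\<And>(n::nat) (t :: nat \<Rightarrow> real) (x :: nat \<Rightarrow> nat).
          0 \<le> t 0 \<Longrightarrow> (\<forall>i\<le>n. t i < t (Suc i)) \<Longrightarrow> (\<forall>i\<le>Suc n. x i \<in> S) \<Longrightarrow>
          measure M {\<omega> \<in> space M. \<forall>i\<le>Suc n. X (t i) \<omega> = x i} =
          measure M {\<omega> \<in> space M. \<forall>i\<le>n. X (t i) \<omega> = x i} *
            P (t (Suc n) - t n) (x n) (x (Suc n))"
    unfolding markov_jump_process_def by blast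
  interpret prob_space M by fact
  define h where "h m = 1 / real (Suc m)" for m
  have h: "h m > 0" for m by (simp add: h_def)
  have h0: "h \<longlonglongrightarrow> 0" unfolding h_def using lim_1_over_n LIMSEQ_Suc by (metis (lifting) ext)
  have hr: "filterlim h (at_right 0) sequentially"
    using h0 h by (intro tendsto_imp_filterlim_at_right) auto
  define Ev where "Ev m k x = {\<omega> \<in> space M. (\<forall>i<k. X (real i * h m) \<omega> \<in> S - {c}) \<and> X (real k * h m) \<omega> = x}" for m k x
  have mX [measurable]: "X (real i * h m) \<in> measurable M (count_space UNIV)" for i m
    using meas h[of m] by (simp add: less_imp_le)
  have mB: "{\<omega> \<in> space M. X (real i * h m) \<omega> \<in> B} \<in> sets M" for i m B
    using measurable_sets[OF mX, of B i m] by (simp add: vimage_def Int_def conj_commute)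
  have [measurable]: "Ev m k x \<in> sets M" for m k x
  proof -
    have "Ev m k x = {\<omega> \<in> space M. X (real k * h m) \<omega> \<in> {x}} -
        (\<Union>i\<in>{..<k}. {\<omega> \<in> space M. X (real i * h m) \<omega> \<in> - (S - {c})})"
      unfolding Ev_def by auto
    then show ?thesis by (simp only:) (intro sets.Diff sets.finite_UN mB finite_lessThan)
  qed
  define a where "a m k x = measure M (Ev m k x)" for m k x
  define r where "r m = (\<Sum>x\<in>S - {c}. \<bar>(\<Sum>y\<in>S. P (h m) x y * f y) - exp (\<alpha> * h m) * f x\<bar>)" for m
  have r: "(\<lambda>m. r m / h m) \<longlonglongrightarrow> 0"
  proof -
    have "(\<lambda>m. \<Sum>x\<in>S - {c}. \<bar>((\<Sum>y\<in>S. P (h m) x y * f y) - exp (\<alpha> * h m) * f x) / h m\<bar>) \<longlonglongrightarrow> (\<Sum>x\<in>S - {c}. \<bar>0\<bar>)"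
      using transition_function_eigenvector[OF P fin _ eig]
      by (intro tendsto_sum tendsto_rabs) (auto intro: filterlim_compose[OF _ hr])
    moreover have "(\<Sum>x\<in>S - {c}. \<bar>((\<Sum>y\<in>S. P (h m) x y * f y) - exp (\<alpha> * h m) * f x) / h m\<bar>) = r m / h m" for m
      using h[of m] by (simp add: r_def sum_divide_distrib)
    ultimately show ?thesis by simp
  qed
  have step: "a m (Suc k) y = (\<Sum>x\<in>S - {c}. a m k x * P (h m) x y)" if "y \<in> S" for m k y
  proof -
    define G where "G x = Ev m k x \<inter> {\<omega> \<in> space M. X (real (Suc k) * h m) \<omega> \<in> {y}}" for x
    have "Ev m (Suc k) y = (\<Union>x\<in>S - {c}. G x)"
      unfolding Ev_def G_def by (auto simp: less_Suc_eq)
    moreover have "disjoint_family_on G (S - {c})"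
      unfolding disjoint_family_on_def G_def Ev_def by blast
    moreover have "G ` (S - {c}) \<subseteq> sets M"
      unfolding G_def by (intro image_subsetI sets.Int mB) measurable
    ultimately have "a m (Suc k) y = (\<Sum>x\<in>S - {c}. measure M (G x))"
      unfolding a_def using fin by (simp add: finite_measure_finite_Union)
    also have "\<dots> = (\<Sum>x\<in>S - {c}. measure M {\<omega> \<in> space M. (\<forall>i<k. X (real i * h m) \<omega> \<in> S - {c}) \<and>
             X (real k * h m) \<omega> = x \<and> X (real (Suc k) * h m) \<omega> = y})"
      unfolding G_def Ev_def by (intro sum.cong refl arg_cong[of _ _ "measure M"]) blast
    also have "\<dots> = (\<Sum>x\<in>S - {c}. a m k x * P (h m) x y)"
    proof (rule sum.cong)
      fix x assume "x \<in> S - {c}"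
      have "real (Suc k) * h m - real k * h m = h m" by (simp add: algebra_simps)
      moreover have "measure M {\<omega> \<in> space M. (\<forall>i<k. X (real i * h m) \<omega> \<in> S - {c}) \<and>
             X (real k * h m) \<omega> = x \<and> X (real (Suc k) * h m) \<omega> = y} =
          measure M {\<omega> \<in> space M. (\<forall>i<k. X (real i * h m) \<omega> \<in> S - {c}) \<and> X (real k * h m) \<omega> = x} *
            P (real (Suc k) * h m - real k * h m) x y"
      proof (rule markov_jump_process_history[where t = "\<lambda>i. real i * h m" and S = S and P = P and X = X])
        fix N :: nat and t :: "nat \<Rightarrow> real" and z :: "nat \<Rightarrow> nat"
        assume "0 \<le> t 0" "\<forall>i\<le>N. t i < t (Suc i)" "\<forall>i\<le>Suc N. z i \<in> S"
        then show "measure M {\<omega> \<in> space M. \<forall>i\<le>Suc N. X (t i) \<omega> = z i} =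
          measure M {\<omega> \<in> space M. \<forall>i\<le>N. X (t i) \<omega> = z i} * P (t (Suc N) - t N) (z N) (z (Suc N))"
          by (rule markov)
      qed (use M fin meas h[of m] \<open>x \<in> S - {c}\<close> that in auto)
      ultimately show "measure M {\<omega> \<in> space M. (\<forall>i<k. X (real i * h m) \<omega> \<in> S - {c}) \<and>
             X (real k * h m) \<omega> = x \<and> X (real (Suc k) * h m) \<omega> = y} = a m k x * P (h m) x y"
        by (simp add: a_def Ev_def)
    qed simp
    finally show ?thesis .
  qed
  have mass: "(\<Sum>x\<in>S. a m k x) \<le> 1" for m k
  proof -
    have "(\<Sum>x\<in>S. a m k x) = measure M (\<Union>x\<in>S. Ev m k x)"
      unfolding a_def by (subst finite_measure_finite_Union) (auto simp: fin disjoint_family_on_def Ev_def)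
    then show ?thesis by simp
  qed
  \<comment> \<open>With mesh \<open>1 / Suc m\<close> this many steps reach time
    \<open>Suc m\<close>: the horizon grows while the mesh shrinks, and the mass not yet absorbed
    carries the vanishing weight exp (- \<alpha> (m + 1)).\<close>
  define n where "n m = Suc m * Suc m" for m
  define F where "F = (\<Sum>x\<in>S - {c}. \<bar>f x\<bar>)"
  define I where "I m = (\<Sum>k\<le>n m. exp (- \<alpha> * h m * real k) * a m k c)" for m
  define A where "A m = (\<Sum>x\<in>S - {c}. a m (n m) x * f x)" for m
  have a1: "0 \<le> a m k x \<and> a m k x \<le> 1" for m k x by (simp add: a_def)
  have est: "\<bar>I m * f c + exp (- \<alpha> * h m * real (n m)) * A m - (\<Sum>x\<in>S. a m 0 x * f x)\<bar> \<le> (r m / h m) / \<alpha>" for m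
  proof -
    have "\<bar>I m * f c + exp (- \<alpha> * h m * real (n m)) * A m - (\<Sum>x\<in>S. a m 0 x * f x)\<bar> \<le> r m / (\<alpha> * h m)"
      unfolding I_def A_def
    proof (rule discounted_absorption_estimate[where p = "P (h m)" and a = "a m", OF fin c])
      show "a m (Suc k) y = (\<Sum>x\<in>S - {c}. a m k x * P (h m) x y)" if "y \<in> S" for k y
        using that by (rule step)
      show "\<bar>(\<Sum>y\<in>S. P (h m) x y * f y) - exp (\<alpha> * h m) * f x\<bar> \<le> r m" if "x \<in> S - {c}" for x
        unfolding r_def using that fin by (intro member_le_sum) auto
    qed (use mass a1 \<alpha> h in \<open>auto simp: r_def sum_nonneg\<close>)
    then show ?thesis by (simp add: field_simps)
  qed
  have init: "(\<Sum>x\<in>S. a m 0 x * f x) = (LINT \<omega>|M. f (X 0 \<omega>))" for m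
  proof -
    have [measurable]: "X 0 \<in> measurable M (count_space UNIV)" using meas by simp
    have "(LINT \<omega>|M. f (X 0 \<omega>)) = (LINT \<omega>|M. (\<Sum>x\<in>S. f x * indicator {\<omega>\<in>space M. X 0 \<omega> = x} \<omega>))"
    proof (rule Bochner_Integration.integral_cong)
      fix \<omega> assume "\<omega> \<in> space M"
      then show "f (X 0 \<omega>) = (\<Sum>x\<in>S. f x * indicator {\<omega>\<in>space M. X 0 \<omega> = x} \<omega>)"
        using inS[of \<omega> 0] fin by (simp add: indicator_def if_distrib[of "\<lambda>z. _ * z"] cong: if_cong)
    qed simp
    also have "\<dots> = (\<Sum>x\<in>S. a m 0 x * f x)"
      by (subst Bochner_Integration.integral_sum) (auto simp: a_def Ev_def mult.commute less_top[symmetric] intro!: integrable_real_indicator)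
    finally show ?thesis by simp
  qed
  have small: "(\<lambda>m. exp (- \<alpha> * h m * real (n m)) * A m) \<longlonglongrightarrow> 0"
  proof (rule Lim_null_comparison)
    have "\<bar>A m\<bar> \<le> F" for m unfolding A_def F_def
      using a1 by (intro order.trans[OF sum_abs] sum_mono) (auto simp: abs_mult intro!: mult_left_le_one_le)
    moreover have hn: "h m * real (n m) = real (Suc m)" for m
      unfolding n_def h_def of_nat_mult by (simp add: field_simps)
    ultimately show "eventually (\<lambda>m. norm (exp (- \<alpha> * h m * real (n m)) * A m) \<le> exp (- \<alpha> * real (Suc m)) * F) sequentially"
      using hn by (intro always_eventually allI) (simp add: abs_mult mult.assoc)
    have "filterlim (\<lambda>m. \<alpha> * real (Suc m)) at_top sequentially"
      using \<alpha> filterlim_compose[OF filterlim_real_sequentially filterlim_Suc]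
      by (intro filterlim_tendsto_pos_mult_at_top[OF tendsto_const])
    then have "(\<lambda>m. exp (- (\<alpha> * real (Suc m)))) \<longlonglongrightarrow> 0"
      by (intro filterlim_compose[OF exp_at_bot] filterlim_uminus_at_bot[THEN iffD1]) (simp add: filterlim_uminus_at_top)
    from tendsto_mult_left_zero[OF this, of F]
    show "(\<lambda>m. exp (- \<alpha> * real (Suc m)) * F) \<longlonglongrightarrow> 0" by simp
  qed
  have lim1: "(\<lambda>m. I m * f c) \<longlonglongrightarrow> (LINT \<omega>|M. f (X 0 \<omega>))"
  proof -
    have "(\<lambda>m. I m * f c + exp (- \<alpha> * h m * real (n m)) * A m - (LINT \<omega>|M. f (X 0 \<omega>))) \<longlonglongrightarrow> 0"
    proof (rule Lim_null_comparison)
      show "eventually (\<lambda>m. norm (I m * f c + exp (- \<alpha> * h m * real (n m)) * A m - (LINT \<omega>|M. f (X 0 \<omega>)))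
          \<le> r m / h m / \<alpha>) sequentially"
        using est unfolding init real_norm_def by (intro always_eventually allI)
      show "(\<lambda>m. r m / h m / \<alpha>) \<longlonglongrightarrow> 0"
        using tendsto_divide[OF r tendsto_const[of \<alpha>]] \<alpha> by simp
    qed
    from tendsto_add[OF tendsto_diff[OF this small] tendsto_const[of "LINT \<omega>|M. f (X 0 \<omega>)"]]
    show ?thesis by simp
  qed
  \<comment> \<open>\<open>V m\<close> realises \<open>I m\<close> as an expectation. Its events are
    disjoint, so on each path it is either the discount factor at the first grid visit or 0. This
    permits a pathwise limit with the dominating constant 1.\<close>
  define V where "V m \<omega> = (\<Sum>k\<le>n m. exp (- \<alpha> * h m * real k) * indicator (Ev m k c) \<omega>)" for m \<omega>
  have IV: "I m = (LINT \<omega>|M. V m \<omega>)" for m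
    unfolding I_def V_def
    by (subst Bochner_Integration.integral_sum) (auto simp: a_def less_top[symmetric] intro!: integrable_real_indicator)
  have V_eq: "V m \<omega> = (if K \<le> n m then exp (- \<alpha> * h m * real K) else 0)"
    if "\<omega> \<in> space M" "X (real K * h m) \<omega> = c" "\<And>k. k < K \<Longrightarrow> X (real k * h m) \<omega> \<noteq> c" for m \<omega> K
  proof -
    have "indicator (Ev m k c) \<omega> = (if k = K then 1 else 0 :: real)" for k
    proof -
      have "\<omega> \<in> Ev m k c \<longleftrightarrow> k = K"
        using that inS[OF that(1), of "real _ * h m"] h[of m] unfolding Ev_def
        by (cases k K rule: linorder_cases) (auto simp: less_imp_le)
      then show ?thesis by (simp add: indicator_def)
    qed
    then show ?thesis by (simp add: V_def if_distrib[of "\<lambda>z. _ * z"] cong: if_cong)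
  qed
  have V0: "V m \<omega> = 0" if "\<And>k. X (real k * h m) \<omega> \<noteq> c" for m \<omega>
    using that by (simp add: V_def Ev_def)
  have bound: "norm (V m \<omega>) \<le> 1" if "\<omega> \<in> space M" for m \<omega>
  proof (cases "\<exists>k. X (real k * h m) \<omega> = c")
    case True
    define K where "K = (LEAST k. X (real k * h m) \<omega> = c)"
    have "X (real K * h m) \<omega> = c" "\<And>k. k < K \<Longrightarrow> X (real k * h m) \<omega> \<noteq> c"
      using LeastI_ex[OF True] not_less_Least by (auto simp: K_def)
    from V_eq[OF that this] show ?thesis using h[of m] \<alpha> by auto
  next
    case False
    then show ?thesis using V0 by auto
  qed
  let ?L = "\<lambda>\<omega>. if hitting_time X c \<omega> < \<infinity> then exp (- \<alpha> * real_of_ereal (hitting_time X c \<omega>)) else 0"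
  have lim: "(\<lambda>m. V m \<omega>) \<longlonglongrightarrow> ?L \<omega>" if om: "\<omega> \<in> space M" for \<omega>
  proof (cases "hitting_time X c \<omega> < \<infinity>")
    case False
    have "X (real k * h m) \<omega> \<noteq> c" for k m
      using hitting_time_le[of X "real k * h m" \<omega> c] False h[of m] by (auto simp: less_imp_le)
    then have "V m \<omega> = 0" for m by (rule V0)
    then show ?thesis using False by simp
  next
    case True
    then obtain T where T: "T \<ge> 0" "hitting_time X c \<omega> = ereal T" "X T \<omega> = c"
      "\<And>s. 0 \<le> s \<Longrightarrow> s < T \<Longrightarrow> X s \<omega> \<noteq> c"
      using hitting_time_attained[of X \<omega> c] cont[OF om] by metis
    obtain e where e: "e > 0" "\<And>s. T \<le> s \<Longrightarrow> s < T + e \<Longrightarrow> X s \<omega> = X T \<omega>"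
      using right_continuous_nat_locally_constant[OF cont[OF om T(1)]] by blast
    have "eventually (\<lambda>m. h m < e) sequentially"
      using order_tendstoD(2)[OF h0 e(1)] .
    moreover have "eventually (\<lambda>m. T \<le> real m) sequentially"
      using filterlim_real_sequentially by (simp add: filterlim_at_top)
    \<comment> \<open>Once the mesh is smaller than the length \<open>e\<close> of the stay at
      \<open>c\<close> beginning at \<open>T\<close>, the first grid point not before
      \<open>T\<close> still sees \<open>c\<close>. The first grid visit is thus between
      \<open>T\<close> and \<open>T + h m\<close>.\<close>
    ultimately have ev: "eventually (\<lambda>m. exp (- \<alpha> * (T + h m)) \<le> V m \<omega> \<and> V m \<omega> \<le> exp (- \<alpha> * T)) sequentially"
    proof eventually_elim
      case (elim m)
      define k0 where "k0 = nat \<lceil>T / h m\<rceil>"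
      have "real k0 = of_int \<lceil>T / h m\<rceil>" using T(1) h[of m] by (simp add: k0_def)
      then have "T / h m \<le> real k0" "real k0 < T / h m + 1" by linarith+
      then have k0: "T \<le> real k0 * h m" "real k0 * h m < T + h m"
        using h[of m] by (auto simp: field_simps)
      have Xk0: "X (real k0 * h m) \<omega> = c" using e(2)[OF k0(1)] k0(2) elim(1) T(3) by simp
      define K where "K = (LEAST k. X (real k * h m) \<omega> = c)"
      have K: "X (real K * h m) \<omega> = c" "\<And>k. k < K \<Longrightarrow> X (real k * h m) \<omega> \<noteq> c" "K \<le> k0"
        using LeastI[of "\<lambda>k. X (real k * h m) \<omega> = c", OF Xk0] not_less_Least Least_le[of "\<lambda>k. X (real k * h m) \<omega> = c", OF Xk0] by (auto simp: K_def)
      have "real K * h m \<le> real k0 * h m" using K(3) h[of m] by (intro mult_right_mono) auto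
      then have K2: "real K * h m \<le> T + h m" using k0 by linarith
      have K1: "T \<le> real K * h m" using T(4)[of "real K * h m"] K(1) h[of m] by (force simp: less_imp_le)
      \<comment> \<open>The visit must also fall within the finite horizon: T (m + 1) + 1 is at most
        (m + 1)^2 as soon as T is at most m.\<close>
      have "real K \<le> (T + h m) * real (Suc m)"
        using K2 by (simp add: h_def field_simps)
      also have "\<dots> = T * real (Suc m) + 1" by (simp add: h_def algebra_simps add_divide_distrib[symmetric])
      also have "\<dots> \<le> real m * real (Suc m) + real (Suc m)"
        using elim(2) by (intro add_mono mult_right_mono) auto
      also have "\<dots> = real (n m)" by (simp add: n_def algebra_simps)
      finally have "K \<le> n m" by simp
      then have "V m \<omega> = exp (- \<alpha> * (real K * h m))" using V_eq[OF om K(1,2)] by (simp add: mult_ac)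
      then show ?case using K1 K2 \<alpha> by (auto intro: mult_left_mono)
    qed
    have "(\<lambda>m. exp (- \<alpha> * (T + h m))) \<longlonglongrightarrow> exp (- \<alpha> * (T + 0))"
      by (intro tendsto_intros h0)
    then have T_lim: "(\<lambda>m. exp (- \<alpha> * (T + h m))) \<longlonglongrightarrow> exp (- \<alpha> * T)" by simp
    have "(\<lambda>m. V m \<omega>) \<longlonglongrightarrow> exp (- \<alpha> * T)"
    proof (rule tendsto_sandwich[OF _ _ T_lim tendsto_const])
      show "eventually (\<lambda>m. exp (- \<alpha> * (T + h m)) \<le> V m \<omega>) sequentially"
        using ev by (rule eventually_mono) blast
      show "eventually (\<lambda>m. V m \<omega> \<le> exp (- \<alpha> * T)) sequentially"
        using ev by (rule eventually_mono) blast
    qed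
    then show ?thesis using True T(2) by simp
  qed
  have [measurable]: "hitting_time X c \<in> borel_measurable M"
    using borel_measurable_hitting_time meas cont by blast
  have "(\<lambda>m. LINT \<omega>|M. V m \<omega>) \<longlonglongrightarrow> (LINT \<omega>|M. ?L \<omega>)"
  proof (rule integral_dominated_convergence[where w = "\<lambda>_. 1"])
    show "V m \<in> borel_measurable M" for m unfolding V_def by measurable
  qed (use lim bound in \<open>auto intro!: AE_I2\<close>)
  then have "(\<lambda>m. I m * f c) \<longlonglongrightarrow> (LINT \<omega>|M. ?L \<omega>) * f c"
    unfolding IV by (intro tendsto_mult tendsto_const)
  from LIMSEQ_unique[OF this lim1] show ?thesis .
qed

section \<open>Continuity of the Laplace transform on the positive half-line\<close>

text \<open>Both characteristic functions lie within 2 |t|^k m k / k! of the same Taylor polynomial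
  \<open>s k\<close>; nonnegativity turns absolute moments into moments, and \<open>growth\<close>
  sends the error to 0.\<close>

lemma nonneg_moments_determine_distribution:
  assumes M1: "real_distribution M1" and M2: "real_distribution M2"
    and nn1: "AE x in M1. 0 \<le> x" and nn2: "AE x in M2. 0 \<le> x"
    and int1: "\<And>k. integrable M1 (\<lambda>x. x ^ k)" and int2: "\<And>k. integrable M2 (\<lambda>x. x ^ k)"
    and eq1: "\<And>k. (LINT x|M1. x ^ k) = m k" and eq2: "\<And>k. (LINT x|M2. x ^ k) = m k"
    and growth: "\<And>t. t > 0 \<Longrightarrow> (\<lambda>k. t ^ k * m k / fact k) \<longlonglongrightarrow> 0"
  shows "M1 = M2"
proof (rule Levy_uniqueness[OF M1 M2], rule ext)
  fix t :: real
  interpret M1: real_distribution M1 by fact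
  interpret M2: real_distribution M2 by fact
  define s where "s k = (\<Sum>j\<le>k. ((\<i> * t) ^ j / fact j) * complex_of_real (m j))" for k
  have 1: "cmod (char M1 t - s k) \<le> 2 * \<bar>t\<bar> ^ k / fact k * m k" for k
  proof -
    have "(LINT x|M1. \<bar>x\<bar> ^ k) = (LINT x|M1. x ^ k)" using nn1 by (intro integral_cong_AE) auto
    then show ?thesis using M1.char_approx1[of k t, OF int1] by (simp add: s_def eq1)
  qed
  have 2: "cmod (char M2 t - s k) \<le> 2 * \<bar>t\<bar> ^ k / fact k * m k" for k
  proof -
    have "(LINT x|M2. \<bar>x\<bar> ^ k) = (LINT x|M2. x ^ k)" using nn2 by (intro integral_cong_AE) auto
    then show ?thesis using M2.char_approx1[of k t, OF int2] by (simp add: s_def eq2)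
  qed
  \<comment> \<open>\<open>growth\<close> is stated for positive arguments; \<bar>t\<bar> + 1
    dominates \<bar>t\<bar> and covers t = 0 as well.\<close>
  have "(\<lambda>k. (\<bar>t\<bar> + 1) ^ k * m k / fact k) \<longlonglongrightarrow> 0" using growth[of "\<bar>t\<bar> + 1"] by simp
  then have lim: "(\<lambda>k. 4 * ((\<bar>t\<bar> + 1) ^ k * m k / fact k)) \<longlonglongrightarrow> 0"
    using tendsto_mult_right_zero by blast
  have m0: "m k \<ge> 0" for k unfolding eq1[symmetric] using nn1 by (intro integral_nonneg_AE) auto
  have "cmod (char M1 t - char M2 t) \<le> 4 * ((\<bar>t\<bar> + 1) ^ k * m k / fact k)" for k
  proof -
    have "cmod (char M1 t - char M2 t) \<le> cmod (char M1 t - s k) + cmod (char M2 t - s k)"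
      by (metis (no_types) dist_norm dist_triangle2)
    also have "\<dots> \<le> 4 * (\<bar>t\<bar> ^ k * m k / fact k)" using 1[of k] 2[of k] by simp
    also have "\<bar>t\<bar> ^ k * m k / fact k \<le> (\<bar>t\<bar> + 1) ^ k * m k / fact k"
      using m0 by (intro divide_right_mono mult_right_mono power_mono) auto
    finally show ?thesis by simp
  qed
  then have "cmod (char M1 t - char M2 t) \<le> 0"
    by (intro LIMSEQ_le_const[OF lim]) auto
  then show "char M1 t = char M2 t" by simp
qed

text \<open>Under x -> exp (- x) the transform at an integer k becomes the k-th moment of a law on
  the positive half-line, and - ln undoes the map. Values at the positive integers are therefore
  enough.\<close>

lemma laplace_transform_determines_distribution:
  fixes M1 M2 :: "real measure"
  assumes M1: "real_distribution M1" and M2: "real_distribution M2"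
    and int1: "\<And>k. k \<ge> 1 \<Longrightarrow> integrable M1 (\<lambda>x. exp (- real k * x))"
    and int2: "\<And>k. k \<ge> 1 \<Longrightarrow> integrable M2 (\<lambda>x. exp (- real k * x))"
    and eq1: "\<And>k. k \<ge> 1 \<Longrightarrow> (LINT x|M1. exp (- real k * x)) = \<phi> k"
    and eq2: "\<And>k. k \<ge> 1 \<Longrightarrow> (LINT x|M2. exp (- real k * x)) = \<phi> k"
    and growth: "\<And>t. t > 0 \<Longrightarrow> (\<lambda>k. t ^ k * \<phi> k / fact k) \<longlonglongrightarrow> 0"
  shows "M1 = M2"
proof -
  interpret M1: real_distribution M1 by fact
  interpret M2: real_distribution M2 by fact
  let ?D = "\<lambda>M. distr M borel (\<lambda>x::real. exp (- x))"
  have pow: "exp (- x) ^ k = exp (- real k * x)" for x :: real and k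
    by (simp flip: exp_of_nat_mult)
  have "?D M1 = ?D M2"
  \<comment> \<open>The moment of order 0 is the total mass 1; \<open>\<phi> 0\<close> is not
    constrained by the hypotheses on the transforms, so it is overridden.\<close>
  proof (rule nonneg_moments_determine_distribution[where m = "\<lambda>k. if k = 0 then 1 else \<phi> k"])
    show "real_distribution (?D M1)" "real_distribution (?D M2)"
      by (auto intro!: M1.real_distribution_distr M2.real_distribution_distr)
    show "AE x in ?D M1. 0 \<le> x" "AE x in ?D M2. 0 \<le> x" by (simp_all add: AE_distr_iff)
    show "integrable (?D M1) (\<lambda>x. x ^ k)" for k
      using int1[of k] by (cases "k = 0") (simp_all add: integrable_distr_eq pow)
    show "integrable (?D M2) (\<lambda>x. x ^ k)" for k
      using int2[of k] by (cases "k = 0") (simp_all add: integrable_distr_eq pow)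
    show "(LINT x|?D M1. x ^ k) = (if k = 0 then 1 else \<phi> k)" for k
      using eq1[of k] M1.prob_space by (subst integral_distr) (auto simp: pow)
    show "(LINT x|?D M2. x ^ k) = (if k = 0 then 1 else \<phi> k)" for k
      using eq2[of k] M2.prob_space by (subst integral_distr) (auto simp: pow)
    show "(\<lambda>k. t ^ k * (if k = 0 then 1 else \<phi> k) / fact k) \<longlonglongrightarrow> 0" if "t > 0" for t :: real
      using growth[OF that] 
      by (rule Lim_transform_eventually) (use eventually_gt_at_top[of "0::nat"] in eventually_elim, simp)
  qed
  then have "distr (?D M1) borel (\<lambda>y. - ln y) = distr (?D M2) borel (\<lambda>y. - ln y)" by simp
  then show ?thesis by (simp add: distr_distr o_def distr_id2)
qed

text \<open>The integrand is continuous but unbounded, so weak convergence applies to its truncation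
  at \<open>K\<close>. For y = exp (- \<alpha> x) one has y - min y K \<le> y^2 / K, and the
  integral of y^2 is the transform at 2 \<alpha>. The bound \<open>B\<close> thus provides uniform
  integrability.\<close>

lemma weak_conv_laplace_limit:
  assumes \<mu>: "\<And>n. real_distribution (\<mu> n)" and M: "real_distribution M" and conv: "weak_conv_m \<mu> M"
    and int: "\<And>n. integrable (\<mu> n) (\<lambda>x. exp (- \<alpha> * x))" "\<And>n. integrable (\<mu> n) (\<lambda>x. exp (- (2 * \<alpha>) * x))"
    and bound: "\<And>n. (LINT x|\<mu> n. exp (- (2 * \<alpha>) * x)) \<le> B"
    and lim: "(\<lambda>n. LINT x|\<mu> n. exp (- \<alpha> * x)) \<longlonglongrightarrow> l"
  shows "integrable M (\<lambda>x. exp (- \<alpha> * x)) \<and> (LINT x|M. exp (- \<alpha> * x)) = l"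
proof -
  interpret M: real_distribution M by fact
  define f where "f K x = min (exp (- \<alpha> * x)) K" for K x :: real
  have [measurable]: "f K \<in> borel_measurable borel" for K unfolding f_def by measurable
  have near: "\<bar>(LINT x|M. f K x) - l\<bar> \<le> B / K" if K: "K > 0" for K
  proof (rule Lim_bounded[of "\<lambda>n. \<bar>(LINT x|\<mu> n. f K x) - (LINT x|\<mu> n. exp (- \<alpha> * x))\<bar>"])
    have "(\<lambda>n. LINT x|\<mu> n. f K x) \<longlonglongrightarrow> (LINT x|M. f K x)"
      using K by (intro weak_conv_imp_integral_bdd_continuous_conv[OF \<mu> M conv, where B = K])
        (auto simp: f_def intro!: continuous_intros)
    then show "(\<lambda>n. \<bar>(LINT x|\<mu> n. f K x) - (LINT x|\<mu> n. exp (- \<alpha> * x))\<bar>) \<longlonglongrightarrow> \<bar>(LINT x|M. f K x) - l\<bar>"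
      by (intro tendsto_intros lim)
    show "\<forall>n\<ge>0. \<bar>(LINT x|\<mu> n. f K x) - (LINT x|\<mu> n. exp (- \<alpha> * x))\<bar> \<le> B / K"
    proof (intro allI impI)
      fix n
      interpret N: real_distribution "\<mu> n" by (rule \<mu>)
      have fint: "integrable (\<mu> n) (f K)"
        using K by (intro N.integrable_const_bound[where B = K]) (auto simp: f_def)
      have "\<bar>(LINT x|\<mu> n. f K x) - (LINT x|\<mu> n. exp (- \<alpha> * x))\<bar> = \<bar>LINT x|\<mu> n. f K x - exp (- \<alpha> * x)\<bar>"
        using fint int by simp
      also have "\<dots> \<le> (LINT x|\<mu> n. \<bar>f K x - exp (- \<alpha> * x)\<bar>)" by (rule integral_abs_bound)
      also have "\<dots> \<le> (LINT x|\<mu> n. exp (- (2 * \<alpha>) * x) / K)"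
      proof (rule integral_mono)
        fix x
        have sq: "exp (- (2 * \<alpha>) * x) = exp (- \<alpha> * x) * exp (- \<alpha> * x)" by (simp flip: exp_add)
        show "\<bar>f K x - exp (- \<alpha> * x)\<bar> \<le> exp (- (2 * \<alpha>) * x) / K"
        proof (cases "exp (- \<alpha> * x) \<le> K")
          case False
          then have "exp (- \<alpha> * x) * K \<le> exp (- \<alpha> * x) * exp (- \<alpha> * x)" by (intro mult_left_mono) auto
          then have "exp (- \<alpha> * x) \<le> exp (- (2 * \<alpha>) * x) / K" using K unfolding sq by (simp add: field_simps)
          then show ?thesis using False K by (simp add: f_def)
        qed (use K in \<open>simp add: f_def\<close>)
      qed (use fint int in auto)
      also have "\<dots> \<le> B / K" using bound[of n] K by (simp add: divide_right_mono)
      finally show "\<bar>(LINT x|\<mu> n. f K x) - (LINT x|\<mu> n. exp (- \<alpha> * x))\<bar> \<le> B / K" .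
    qed
  qed
  \<comment> \<open>Integrability under the limit law is still open here. Removing the truncation
    along \<open>K = Suc i\<close> by monotone convergence gives integrability and the value
    together.\<close>
  have lim2: "(\<lambda>i. LINT x|M. f (real (Suc i)) x) \<longlonglongrightarrow> l"
  proof -
    have "(\<lambda>i. (LINT x|M. f (real (Suc i)) x) - l) \<longlonglongrightarrow> 0"
    proof (rule Lim_null_comparison)
      show "eventually (\<lambda>i. norm ((LINT x|M. f (real (Suc i)) x) - l) \<le> B / real (Suc i)) sequentially"
        unfolding real_norm_def by (intro always_eventually allI near) simp
      show "(\<lambda>i. B / real (Suc i)) \<longlonglongrightarrow> 0" using lim_const_over_n LIMSEQ_Suc by blast
    qed
    then show ?thesis by (simp add: LIM_zero_iff)
  qed
  have fint: "integrable M (f (real (Suc i)))" for i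
    by (intro M.integrable_const_bound[where B = "real (Suc i)"]) (auto simp: f_def)
  have mono: "AE x in M. mono (\<lambda>i. f (real (Suc i)) x)"
    by (intro AE_I2) (auto simp: mono_def f_def)
  have pw: "AE x in M. (\<lambda>i. f (real (Suc i)) x) \<longlonglongrightarrow> exp (- \<alpha> * x)"
  proof (intro AE_I2)
    fix x
    obtain i0 where "exp (- \<alpha> * x) \<le> real i0" using real_arch_simple by blast
    then have "eventually (\<lambda>i. f (real (Suc i)) x = exp (- \<alpha> * x)) sequentially"
      by (intro eventually_sequentiallyI[of i0]) (auto simp: f_def)
    then show "(\<lambda>i. f (real (Suc i)) x) \<longlonglongrightarrow> exp (- \<alpha> * x)" by (rule tendsto_eventually)
  qed
  have meas: "(\<lambda>x. exp (- \<alpha> * x)) \<in> borel_measurable M" by measurable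
  from integrable_monotone_convergence[OF fint mono pw lim2 meas]
    integral_monotone_convergence[OF fint mono pw lim2 meas]
  show ?thesis by blast
qed

section \<open>Tightness and convergence from Laplace transforms\<close>

lemma (in real_distribution) symmetric_interval_mass:
  assumes "\<epsilon> > 0"
  shows "eventually (\<lambda>K. measure M {- K<..K} > 1 - \<epsilon>) at_top"
proof -
  have "((\<lambda>K. cdf M K - cdf M (- K)) \<longlongrightarrow> 1 - 0) at_top"
    by (intro tendsto_diff cdf_lim_at_top_prob filterlim_compose[OF cdf_lim_at_bot filterlim_uminus_at_bot_at_top])
  then have "eventually (\<lambda>K. cdf M K - cdf M (- K) > 1 - \<epsilon>) at_top"
    by (rule order_tendstoD) (use assms in simp)
  with eventually_gt_at_top[of 0] show ?thesis
    by eventually_elim (simp add: cdf_diff_eq)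
qed

text \<open>The finitely many laws before the index where the estimate starts are each concentrated
  on some interval; a common larger interval serves them and the rest.\<close>

lemma tight_eventuallyI:
  assumes \<mu>: "\<And>n. real_distribution (\<mu> n)"
    and K: "\<And>\<epsilon>. \<epsilon> > 0 \<Longrightarrow> \<exists>K. eventually (\<lambda>n. measure (\<mu> n) {- K<..K} > 1 - \<epsilon>) sequentially"
  shows "tight \<mu>"
  unfolding tight_def
proof (intro conjI allI impI)
  fix \<epsilon> :: real assume \<epsilon>: "\<epsilon> > 0"
  from K[OF \<epsilon>] obtain K n0 where K: "\<And>n. n \<ge> n0 \<Longrightarrow> measure (\<mu> n) {- K<..K} > 1 - \<epsilon>"
    by (auto simp: eventually_sequentially)
  have "eventually (\<lambda>L. \<forall>n\<in>{..<n0}. measure (\<mu> n) {- L<..L} > 1 - \<epsilon>) at_top"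
    using real_distribution.symmetric_interval_mass[OF \<mu> \<epsilon>]
    by (intro eventually_ball_finite) auto
  then have "eventually (\<lambda>L. \<forall>n<n0. measure (\<mu> n) {- L<..L} > 1 - \<epsilon>) at_top"
    by (simp add: Ball_def)
  then have "eventually (\<lambda>L. L > 0 \<and> L \<ge> K \<and> (\<forall>n<n0. measure (\<mu> n) {- L<..L} > 1 - \<epsilon>)) at_top"
    using eventually_gt_at_top eventually_ge_at_top by (intro eventually_conj) auto
  then obtain L where L: "L > 0" "L \<ge> K" "\<And>n. n < n0 \<Longrightarrow> measure (\<mu> n) {- L<..L} > 1 - \<epsilon>"
    using eventually_happens trivial_limit_at_top_linorder by (metis (no_types, lifting))
  have "measure (\<mu> n) {- L<..L} > 1 - \<epsilon>" for n
  proof (cases "n < n0")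
    case False
    interpret real_distribution "\<mu> n" by (rule \<mu>)
    have "measure (\<mu> n) {- K<..K} \<le> measure (\<mu> n) {- L<..L}"
      using L(2) by (intro finite_measure_mono) auto
    then show ?thesis using K[of n] False by simp
  qed (rule L)
  then show "\<exists>a b. a < b \<and> (\<forall>n. 1 - \<epsilon> < measure (\<mu> n) {a<..b})"
    using L(1) by (intro exI[of _ "- L"] exI[of _ L]) auto
qed (rule \<mu>)

text \<open>The bound on the upper tail comes from \<open>exp (- \<alpha> x) \<le> 1 - \<alpha> + \<alpha> exp (- x)\<close>, which is
  concavity of \<open>w \<mapsto> w powr \<alpha>\<close> at \<open>w = exp (- x)\<close>.\<close>

lemma (in real_distribution) laplace_tail_bounds:
  assumes int: "\<And>a. a > 0 \<Longrightarrow> integrable M (\<lambda>x. exp (- a * x))"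
    and \<alpha>: "0 < \<alpha>" "\<alpha> \<le> 1" and K: "K > 0" "exp (- \<alpha> * K) \<le> 1 / 2"
  shows "measure M {- K<..K} \<ge> 1 - exp (- K) * (LINT x|M. exp (- x))
     - 2 * (1 - (LINT x|M. exp (- \<alpha> * x)) + \<alpha> * (LINT x|M. exp (- x)))"
proof -
  have i1: "integrable M (\<lambda>x. exp (- x))" using int[of 1] by simp
  have ia: "integrable M (\<lambda>x. exp (- \<alpha> * x))" using int \<alpha> by simp
  have low: "measure M {.. - K} \<le> exp (- K) * (LINT x|M. exp (- x))"
  proof -
    have "measure M {.. - K} = (LINT x|M. indicator {.. - K} x)" by simp
    also have "\<dots> \<le> (LINT x|M. exp (- K) * exp (- x))"
    proof (rule integral_mono)
      show "integrable M (\<lambda>x. indicator {.. - K} x :: real)" by (simp add: less_top[symmetric])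
      show "indicator {.. - K} x \<le> exp (- K) * exp (- x)" for x
        by (auto simp: indicator_def simp flip: exp_add)
    qed (use i1 in simp)
    finally show ?thesis by simp
  qed
  have up: "measure M {K<..} \<le> 2 * (1 - (LINT x|M. exp (- \<alpha> * x)) + \<alpha> * (LINT x|M. exp (- x)))"
  proof -
    have pt: "exp (- \<alpha> * x) \<le> 1 + \<alpha> * exp (- x) - indicator {K<..} x / 2" for x
    proof (cases "x > K")
      case True
      have "exp (- \<alpha> * x) \<le> exp (- \<alpha> * K)" using True \<alpha> by simp
      also have "\<dots> \<le> 1 / 2" by (rule K)
      also have "\<dots> \<le> 1 / 2 + \<alpha> * exp (- x)" using \<alpha> by simp
      finally show ?thesis using True by simp
    next
      case False
      have "exp (\<alpha> * (- x) + (1 - \<alpha>) * 0) \<le> \<alpha> * exp (- x) + (1 - \<alpha>) * exp 0"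
        using convex_onD[OF exp_convex, of \<alpha> 0 "- x"] \<alpha> by simp
      then show ?thesis using False \<alpha> by simp
    qed
    have "(LINT x|M. exp (- \<alpha> * x)) \<le> (LINT x|M. 1 + \<alpha> * exp (- x) - indicator {K<..} x / 2)"
      using i1 ia by (intro integral_mono pt Bochner_Integration.integrable_diff Bochner_Integration.integrable_add)
        (auto simp: less_top[symmetric])
    also have "\<dots> = 1 + \<alpha> * (LINT x|M. exp (- x)) - measure M {K<..} / 2"
      using i1 prob_space by (subst Bochner_Integration.integral_diff) (auto simp: less_top[symmetric])
    finally show ?thesis by simp
  qed
  have "1 = measure M ({.. - K} \<union> {- K<..K} \<union> {K<..})"
  proof -
    have "{.. - K} \<union> {- K<..K} \<union> {K<..} = space M" using K by auto
    then show ?thesis using prob_space by metis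
  qed
  also have "\<dots> \<le> measure M {.. - K} + measure M {- K<..K} + measure M {K<..}"
    by (intro order.trans[OF measure_Un_le] add_mono order.refl) auto
  finally show ?thesis using low up by linarith
qed

text \<open>Every weak subsequential limit has transform \<open>\<phi>\<close>, so by uniqueness
  there is only one, and tightness extends the convergence to the whole sequence. The hypothesis
  \<open>zero\<close> serves tightness, \<open>growth\<close> serves uniqueness.\<close>

theorem laplace_continuity:
  fixes \<mu> :: "nat \<Rightarrow> real measure" and \<phi> :: "real \<Rightarrow> real"
  assumes \<mu>: "\<And>n. real_distribution (\<mu> n)"
    and int: "\<And>n \<alpha>. \<alpha> > 0 \<Longrightarrow> integrable (\<mu> n) (\<lambda>x. exp (- \<alpha> * x))"
    and lim: "\<And>\<alpha>. \<alpha> > 0 \<Longrightarrow> (\<lambda>n. LINT x|\<mu> n. exp (- \<alpha> * x)) \<longlonglongrightarrow> \<phi> \<alpha>"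
    and zero: "(\<phi> \<longlongrightarrow> 1) (at_right 0)"
    and growth: "\<And>t. t > 0 \<Longrightarrow> (\<lambda>k. t ^ k * \<phi> (real k) / fact k) \<longlonglongrightarrow> 0"
  obtains M where "real_distribution M" "weak_conv_m \<mu> M"
    "\<And>\<alpha>. \<alpha> > 0 \<Longrightarrow> integrable M (\<lambda>x. exp (- \<alpha> * x)) \<and> (LINT x|M. exp (- \<alpha> * x)) = \<phi> \<alpha>"
proof -
  have transform: "integrable \<nu> (\<lambda>x. exp (- \<alpha> * x)) \<and> (LINT x|\<nu>. exp (- \<alpha> * x)) = \<phi> \<alpha>"
    if s: "strict_mono s" and \<nu>: "real_distribution \<nu>" and conv: "weak_conv_m (\<mu> \<circ> s) \<nu>" and \<alpha>: "\<alpha> > 0" for s \<nu> \<alpha>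
  proof -
    have "Bseq (\<lambda>n. LINT x|(\<mu> \<circ> s) n. exp (- (2 * \<alpha>) * x))"
      using LIMSEQ_subseq_LIMSEQ[OF lim[of "2 * \<alpha>"] s] \<alpha> by (intro convergent_imp_Bseq convergentI) (auto simp: o_def)
    then obtain B where "\<And>n. norm (LINT x|(\<mu> \<circ> s) n. exp (- (2 * \<alpha>) * x)) \<le> B" by (auto simp: Bseq_def)
    then have B: "(LINT x|(\<mu> \<circ> s) n. exp (- (2 * \<alpha>) * x)) \<le> B" for n
      using norm_ge_zero abs_le_D1 real_norm_def by metis
    show ?thesis
    proof (rule weak_conv_laplace_limit[OF _ \<nu> conv _ _ B])
      show "(\<lambda>n. LINT x|(\<mu> \<circ> s) n. exp (- \<alpha> * x)) \<longlonglongrightarrow> \<phi> \<alpha>"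
        using LIMSEQ_subseq_LIMSEQ[OF lim[OF \<alpha>] s] by (simp add: o_def)
    qed (use \<mu> int \<alpha> in auto)
  qed
  have unique: "\<nu>1 = \<nu>2" if "strict_mono s1" "real_distribution \<nu>1" "weak_conv_m (\<mu> \<circ> s1) \<nu>1"
    "strict_mono s2" "real_distribution \<nu>2" "weak_conv_m (\<mu> \<circ> s2) \<nu>2" for s1 s2 \<nu>1 \<nu>2
    using transform[OF that(1-3)] transform[OF that(4-6)]
    by (intro laplace_transform_determines_distribution[OF that(2,5), where \<phi> = "\<lambda>k. \<phi> (real k)"] growth) auto
  have tight: "tight \<mu>"
  proof (rule tight_eventuallyI[OF \<mu>])
    fix \<epsilon> :: real assume \<epsilon>: "\<epsilon> > 0"
    \<comment> \<open>The order of choices matters: \<alpha> is taken close to 0 to make the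
      limiting bound on the upper tail small, and only then K, depending on \<alpha>, so large that
      exp (- \<alpha> K) < 1/2 and the lower tail is small.\<close>
    have "((\<lambda>\<alpha>. 2 * (1 - \<phi> \<alpha> + \<alpha> * \<phi> 1)) \<longlongrightarrow> 2 * (1 - 1 + 0 * \<phi> 1)) (at_right 0)"
      by (intro tendsto_intros zero)
    then have "eventually (\<lambda>\<alpha>. 2 * (1 - \<phi> \<alpha> + \<alpha> * \<phi> 1) < \<epsilon> / 2) (at_right 0)"
      by (rule order_tendstoD) (use \<epsilon> in simp)
    moreover have "eventually (\<lambda>\<alpha>::real. 0 < \<alpha> \<and> \<alpha> \<le> 1) (at_right 0)"
      by (auto simp: eventually_at_right_field intro!: exI[of _ 1])
    ultimately have "eventually (\<lambda>\<alpha>. 2 * (1 - \<phi> \<alpha> + \<alpha> * \<phi> 1) < \<epsilon> / 2 \<and> 0 < \<alpha> \<and> \<alpha> \<le> 1) (at_right 0)"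
      by eventually_elim auto
    then obtain \<alpha> where \<alpha>: "2 * (1 - \<phi> \<alpha> + \<alpha> * \<phi> 1) < \<epsilon> / 2" "0 < \<alpha>" "\<alpha> \<le> 1"
      using eventually_happens trivial_limit_at_right_real by blast
    have ez: "((\<lambda>K. exp (- (a * K))) \<longlongrightarrow> 0) at_top" if "a > 0" for a :: real
      using that by (intro filterlim_compose[OF exp_at_bot] filterlim_uminus_at_top[THEN iffD1]
        filterlim_tendsto_pos_mult_at_top[OF tendsto_const _ filterlim_ident])
    have "eventually (\<lambda>K. exp (- (\<alpha> * K)) < 1 / 2) at_top"
      by (rule order_tendstoD[OF ez]) (use \<alpha> in auto)
    moreover have "eventually (\<lambda>K. exp (- (1 * K)) * \<phi> 1 < \<epsilon> / 4) at_top"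
      using tendsto_mult_left_zero[OF ez[of 1], of "\<phi> 1"] by (rule order_tendstoD) (use \<epsilon> in auto)
    ultimately have "eventually (\<lambda>K. exp (- (\<alpha> * K)) < 1 / 2 \<and> exp (- (1 * K)) * \<phi> 1 < \<epsilon> / 4 \<and> K > 0) at_top"
      using eventually_gt_at_top[of 0] by eventually_elim auto
    then obtain K where K: "exp (- (\<alpha> * K)) < 1 / 2" "exp (- K) * \<phi> 1 < \<epsilon> / 4" "K > 0"
      using eventually_happens trivial_limit_at_top_linorder by fastforce
    have "(\<lambda>n. 1 - exp (- K) * (LINT x|\<mu> n. exp (- 1 * x))
         - 2 * (1 - (LINT x|\<mu> n. exp (- \<alpha> * x)) + \<alpha> * (LINT x|\<mu> n. exp (- 1 * x))))
       \<longlonglongrightarrow> 1 - exp (- K) * \<phi> 1 - 2 * (1 - \<phi> \<alpha> + \<alpha> * \<phi> 1)"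
      using \<alpha>(2) by (intro tendsto_intros lim) auto
    then have "eventually (\<lambda>n. 1 - \<epsilon> < 1 - exp (- K) * (LINT x|\<mu> n. exp (- 1 * x))
         - 2 * (1 - (LINT x|\<mu> n. exp (- \<alpha> * x)) + \<alpha> * (LINT x|\<mu> n. exp (- 1 * x)))) sequentially"
      by (rule order_tendstoD) (use \<alpha>(1) K(2) \<epsilon> in linarith)
    then have "eventually (\<lambda>n. measure (\<mu> n) {- K<..K} > 1 - \<epsilon>) sequentially"
    proof eventually_elim
      case (elim n)
      have "measure (\<mu> n) {- K<..K} \<ge> 1 - exp (- K) * (LINT x|\<mu> n. exp (- x))
         - 2 * (1 - (LINT x|\<mu> n. exp (- \<alpha> * x)) + \<alpha> * (LINT x|\<mu> n. exp (- x)))"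
        using \<alpha> K by (intro real_distribution.laplace_tail_bounds[OF \<mu> int]) auto
      with elim show ?case by simp
    qed
    then show "\<exists>K. eventually (\<lambda>n. measure (\<mu> n) {- K<..K} > 1 - \<epsilon>) sequentially" by blast
  qed
  obtain r M where r: "strict_mono r" and M: "real_distribution M" and rM: "weak_conv_m (\<mu> \<circ> r) M"
    using tight_imp_convergent_subsubsequence[OF tight strict_mono_id] by auto
  have "weak_conv_m \<mu> M"
  proof (rule tight_subseq_weak_converge[OF \<mu> M tight])
    fix s \<nu> assume *: "strict_mono s" "real_distribution \<nu>" "weak_conv_m (\<mu> \<circ> s) \<nu>"
    then have "\<nu> = M" using r M rM by (rule unique)
    with * show "weak_conv_m (\<mu> \<circ> s) M" by simp
  qed
  then show ?thesis using that[OF M] transform[OF r M rM] by blast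
qed

section \<open>Mellin transforms of Gaussian kernels\<close>

lemma set_integrable_Gamma_integral:
  fixes \<alpha> :: real
  assumes "\<alpha> > 0"
  shows "set_integrable lborel {0<..} (\<lambda>u. exp (- u) * u powr (\<alpha> - 1))"
    and "(LINT u:{0<..}|lborel. exp (- u) * u powr (\<alpha> - 1)) = Gamma \<alpha>"
proof -
  have eq: "(\<lambda>u. u powr (\<alpha> - 1) / exp u) = (\<lambda>u::real. exp (- u) * u powr (\<alpha> - 1))"
    by (auto simp: exp_minus field_simps)
  have "((\<lambda>u. exp (- u) * u powr (\<alpha> - 1)) has_integral Gamma \<alpha>) {0..}"
    using Gamma_integral_real[OF assms] unfolding eq .
  then have hi: "((\<lambda>u. exp (- u) * u powr (\<alpha> - 1)) has_integral Gamma \<alpha>) {0<..}"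
    by (subst (asm) has_integral_spike_set_eq[of "{0..}" "{0<..}"]) (auto intro: negligible_subset[OF negligible_sing[of 0]])
  then have "(\<lambda>u. exp (- u) * u powr (\<alpha> - 1)) absolutely_integrable_on {0<..}"
    by (intro nonnegative_absolutely_integrable_1) auto
  then show int: "set_integrable lborel {0<..} (\<lambda>u. exp (- u) * u powr (\<alpha> - 1))"
    unfolding set_integrable_def by (subst (asm) integrable_completion) auto
  show "(LINT u:{0<..}|lborel. exp (- u) * u powr (\<alpha> - 1)) = Gamma \<alpha>"
    using hi set_borel_integral_eq_integral(2)[OF int] by (simp add: integral_unique)
qed

lemma Gamma_real_plus1: "\<alpha> > 0 \<Longrightarrow> Gamma (\<alpha> + 1) = \<alpha> * Gamma \<alpha>" for \<alpha> :: real
  by (rule Gamma_plus1) (auto elim!: nonpos_Ints_cases)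

lemma set_integral_mono_subset:
  fixes f :: "'a \<Rightarrow> real"
  assumes "set_integrable M B f" "A \<in> sets M" "A \<subseteq> B" "\<And>x. x \<in> B \<Longrightarrow> 0 \<le> f x"
  shows "(LINT x:A|M. f x) \<le> (LINT x:B|M. f x)"
  using set_integrable_subset[OF assms(1-3)] assms unfolding set_integrable_def set_lebesgue_integral_def
  by (intro integral_mono) (auto simp: indicator_def)

text \<open>At a = \<delta> / \<nu> and b = (1 - \<nu>) / \<nu> this is the denominator of the
  limiting transform. Both parameters stay free because the dominating function uses another pair
  and rescaling changes them.\<close>

definition gauss_mellin :: "real \<Rightarrow> real \<Rightarrow> real \<Rightarrow> real" where
  "gauss_mellin a b \<alpha> = (LINT u:{0<..}|lborel. exp (u * a - u\<^sup>2 / 2 * b) * u powr (\<alpha> - 1))"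

text \<open>The majorant has to equal 1 at u = 0: integrated against u^(\<alpha> - 1) it gives Gamma
  \<alpha> times 1 + K \<alpha>, which is sharp as \<alpha> tends to 0. A constant multiple of exp
  (- u) would lose the limit 1.\<close>

lemma gauss_exponential_bound:
  fixes a b :: real
  assumes "b > 0"
  obtains K where "K \<ge> 0" "\<And>u. u > 0 \<Longrightarrow> exp (u * a - u\<^sup>2 / 2 * b) \<le> (1 + K * u) * exp (- u)"
proof -
  \<comment> \<open>The extra 1 in \<open>A\<close> pays for the factor exp (- u). In
    \<open>K\<close>, the term exp A is the slope of a chord of the exponential, used for u \<le> 1,
    and the other term is the maximum of the Gaussian, found by completing the square, used for u >
    1.\<close>
  define A where "A = \<bar>a\<bar> + 1"
  define K where "K = exp A + exp (A\<^sup>2 / (2 * b))"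
  have *: "exp (u * A - u\<^sup>2 / 2 * b) \<le> 1 + K * u" if u: "u > 0" for u
  proof (cases "u \<le> 1")
    case True
    have "exp (u * A - u\<^sup>2 / 2 * b) \<le> exp (u * A + (1 - u) * 0)" using assms u by simp
    also have "\<dots> \<le> u * exp A + (1 - u) * exp 0"
      using convex_onD[OF exp_convex, of u 0 A] u True by simp
    also have "\<dots> \<le> 1 + exp A * u" using u by simp
    also have "\<dots> \<le> 1 + K * u" using u by (simp add: K_def algebra_simps)
    finally show ?thesis .
  next
    case False
    have "0 \<le> (A - b * u)\<^sup>2 / (2 * b)" using assms by simp
    also have "\<dots> = A\<^sup>2 / (2 * b) - (u * A - u\<^sup>2 / 2 * b)"
      using assms by (simp add: power2_eq_square field_simps)
    finally have "exp (u * A - u\<^sup>2 / 2 * b) \<le> exp (A\<^sup>2 / (2 * b))" by simp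
    also have "\<dots> \<le> K * 1" by (simp add: K_def)
    also have "\<dots> \<le> K * u" using False by (intro mult_left_mono) (auto simp: K_def)
    finally show ?thesis by simp
  qed
  show ?thesis
  proof (rule that[of K])
    fix u :: real assume u: "u > 0"
    have "u * a \<le> u * A - u" using u by (simp add: A_def algebra_simps mult_left_mono)
    then have "exp (u * a - u\<^sup>2 / 2 * b) \<le> exp (u * A - u\<^sup>2 / 2 * b) * exp (- u)"
      by (simp flip: exp_add)
    also have "\<dots> \<le> (1 + K * u) * exp (- u)" using *[OF u] by (intro mult_right_mono) auto
    finally show "exp (u * a - u\<^sup>2 / 2 * b) \<le> (1 + K * u) * exp (- u)" .
  qed (simp add: K_def)
qed

lemma powr_shift: "u > 0 \<Longrightarrow> u * u powr (\<alpha> - 1) = u powr \<alpha>" for u \<alpha> :: real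
  by (simp add: powr_diff)

lemma set_integrable_linear_Gamma:
  fixes \<alpha> :: real
  assumes "\<alpha> > 0"
  shows "set_integrable lborel {0<..} (\<lambda>u. (1 + K * u) * exp (- u) * u powr (\<alpha> - 1))"
    and "(LINT u:{0<..}|lborel. (1 + K * u) * exp (- u) * u powr (\<alpha> - 1)) = Gamma \<alpha> * (1 + K * \<alpha>)"
proof -
  have eq: "(1 + K * u) * exp (- u) * u powr (\<alpha> - 1) =
      exp (- u) * u powr (\<alpha> - 1) + K * (exp (- u) * u powr (\<alpha> + 1 - 1))" if "u \<in> {0<..}" for u
    using powr_shift[of u \<alpha>] that by (simp add: algebra_simps)
  note G = set_integrable_Gamma_integral[OF assms] set_integrable_Gamma_integral[of "\<alpha> + 1"]
  have "set_integrable lborel {0<..} (\<lambda>u. exp (- u) * u powr (\<alpha> - 1) + K * (exp (- u) * u powr (\<alpha> + 1 - 1)))"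
    using G assms by (intro set_integral_add set_integrable_mult_right) auto
  then show "set_integrable lborel {0<..} (\<lambda>u. (1 + K * u) * exp (- u) * u powr (\<alpha> - 1))"
    using eq by (subst set_integrable_cong) auto
  have "(LINT u:{0<..}|lborel. (1 + K * u) * exp (- u) * u powr (\<alpha> - 1)) =
     (LINT u:{0<..}|lborel. exp (- u) * u powr (\<alpha> - 1) + K * (exp (- u) * u powr (\<alpha> + 1 - 1)))"
    using eq by (intro set_lebesgue_integral_cong) auto
  also have "\<dots> = Gamma \<alpha> + K * Gamma (\<alpha> + 1)"
    using G assms by (subst set_integral_add) auto
  also have "\<dots> = Gamma \<alpha> * (1 + K * \<alpha>)"
    using assms unfolding Gamma_real_plus1[OF assms] by (simp add: algebra_simps)
  finally show "(LINT u:{0<..}|lborel. (1 + K * u) * exp (- u) * u powr (\<alpha> - 1)) = Gamma \<alpha> * (1 + K * \<alpha>)" .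
qed

lemma set_integrable_gauss_mellin:
  fixes \<alpha> a b :: real
  assumes "\<alpha> > 0" "b > 0"
  shows "set_integrable lborel {0<..} (\<lambda>u. exp (u * a - u\<^sup>2 / 2 * b) * u powr (\<alpha> - 1))"
proof -
  obtain K where K: "K \<ge> 0" "\<And>u. u > 0 \<Longrightarrow> exp (u * a - u\<^sup>2 / 2 * b) \<le> (1 + K * u) * exp (- u)"
    using gauss_exponential_bound[OF assms(2)] by metis
  show ?thesis
  proof (rule set_integrable_bound[OF set_integrable_linear_Gamma(1)[OF assms(1), of K]])
    show "set_borel_measurable lborel {0<..} (\<lambda>u. exp (u * a - u\<^sup>2 / 2 * b) * u powr (\<alpha> - 1))"
      unfolding set_borel_measurable_def by measurable
    show "AE u in lborel. u \<in> {0<..} \<longrightarrow> norm (exp (u * a - u\<^sup>2 / 2 * b) * u powr (\<alpha> - 1)) \<le>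
       norm ((1 + K * u) * exp (- u) * u powr (\<alpha> - 1))"
      using K by (intro AE_I2) (auto simp: abs_mult intro!: mult_right_mono)
  qed
qed

text \<open>Beyond \<open>R\<close> the power is at least R^(\<alpha> - 1), and \<open>c\<close> is
  the weight of that region. Since \<open>R\<close> is arbitrary, the Mellin transform outgrows
  every geometric sequence.\<close>

lemma gauss_mellin_lower_bound:
  assumes "b > 0" "R > 0"
  obtains c where "c > 0" "\<And>\<alpha>. \<alpha> \<ge> 1 \<Longrightarrow> c * R powr (\<alpha> - 1) \<le> gauss_mellin a b \<alpha>"
proof -
  define g where "g u = exp (u * a - u\<^sup>2 / 2 * b)" for u
  define c where "c = (LINT u:{R<..}|lborel. g u)"
  have gi: "set_integrable lborel {R<..} g"
  proof -
    have "set_integrable lborel {0<..} (\<lambda>u. g u * u powr (1 - 1))"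
      unfolding g_def using assms by (intro set_integrable_gauss_mellin) auto
    then have "set_integrable lborel {R<..} (\<lambda>u. g u * u powr (1 - 1))"
      by (rule set_integrable_subset) (use assms in auto)
    then show ?thesis
      by (subst (asm) set_integrable_cong[of lborel lborel "{R<..}" "{R<..}" _ g]) (use assms in auto)
  qed
  show ?thesis
  proof (rule that)
    \<comment> \<open>Positivity of \<open>c\<close> is read off from a constant lower bound of the
      weight on a unit interval.\<close>
    have "(LINT u:{R<..<R+1}|lborel. exp (- ((R + 1) * \<bar>a\<bar>) - (R + 1)\<^sup>2 / 2 * b)) \<le> (LINT u:{R<..<R+1}|lborel. g u)"
    proof (rule set_integral_mono)
      show "set_integrable lborel {R<..<R + 1} g"
        using gi by (rule set_integrable_subset) auto
      show "set_integrable lborel {R<..<R + 1} (\<lambda>u. exp (- ((R + 1) * \<bar>a\<bar>) - (R + 1)\<^sup>2 / 2 * b))"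
        unfolding set_integrable_def by (intro integrable_scaleR_left) auto
      fix u assume u: "u \<in> {R<..<R + 1}"
      have "\<bar>u * a\<bar> \<le> (R + 1) * \<bar>a\<bar>" using u assms by (auto simp: abs_mult intro!: mult_right_mono)
      moreover have "u\<^sup>2 / 2 * b \<le> (R + 1)\<^sup>2 / 2 * b"
        using u assms by (intro mult_right_mono divide_right_mono power_mono) auto
      ultimately show "exp (- ((R + 1) * \<bar>a\<bar>) - (R + 1)\<^sup>2 / 2 * b) \<le> g u"
        unfolding g_def exp_le_cancel_iff by linarith
    qed
    also have "\<dots> \<le> c"
      unfolding c_def by (intro set_integral_mono_subset[OF gi]) (auto simp: g_def)
    finally show "c > 0" by (simp add: set_lebesgue_integral_def less_le_trans[OF exp_gt_zero])
  next
    fix \<alpha> :: real assume \<alpha>: "\<alpha> \<ge> 1"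
    have gm: "set_integrable lborel {0<..} (\<lambda>u. g u * u powr (\<alpha> - 1))"
      unfolding g_def using \<alpha> assms by (intro set_integrable_gauss_mellin) auto
    have "c * R powr (\<alpha> - 1) = (LINT u:{R<..}|lborel. g u * R powr (\<alpha> - 1))" by (simp add: c_def)
    also have "\<dots> \<le> (LINT u:{R<..}|lborel. g u * u powr (\<alpha> - 1))"
    proof (rule set_integral_mono)
      show "set_integrable lborel {R<..} (\<lambda>u. g u * u powr (\<alpha> - 1))"
        using assms by (intro set_integrable_subset[OF gm]) auto
      show "set_integrable lborel {R<..} (\<lambda>u. g u * R powr (\<alpha> - 1))"
        using gi by (rule set_integrable_mult_left)
      show "g u * R powr (\<alpha> - 1) \<le> g u * u powr (\<alpha> - 1)" if "u \<in> {R<..}" for u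
        using that \<alpha> assms by (intro mult_left_mono powr_mono2) (auto simp: g_def)
    qed
    also have "\<dots> \<le> (LINT u:{0<..}|lborel. g u * u powr (\<alpha> - 1))"
      using assms by (intro set_integral_mono_subset[OF gm]) (auto simp: g_def)
    finally show "c * R powr (\<alpha> - 1) \<le> gauss_mellin a b \<alpha>" by (simp add: gauss_mellin_def g_def)
  qed
qed

text \<open>The lower bound splits off exp (- u) and applies 1 + z \<le> exp z to z = (a + 1) u - b
  u^2 / 2; the functional equation of Gamma evaluates the result. Both bounds are Gamma \<alpha>
  times 1 + O(\<alpha>).\<close>

lemma gauss_mellin_Gamma_bounds:
  assumes "\<alpha> > 0" "b > 0" and K: "\<And>u. u > 0 \<Longrightarrow> exp (u * a - u\<^sup>2 / 2 * b) \<le> (1 + K * u) * exp (- u)"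
  shows "gauss_mellin a b \<alpha> \<le> Gamma \<alpha> * (1 + K * \<alpha>)"
    and "Gamma \<alpha> * (1 + (a + 1) * \<alpha> - b / 2 * (\<alpha> * (\<alpha> + 1))) \<le> gauss_mellin a b \<alpha>"
proof -
  note int = set_integrable_gauss_mellin[OF assms(1,2), of a]
  show "gauss_mellin a b \<alpha> \<le> Gamma \<alpha> * (1 + K * \<alpha>)"
    unfolding gauss_mellin_def set_integrable_linear_Gamma(2)[OF assms(1), symmetric]
    using K by (intro set_integral_mono int set_integrable_linear_Gamma assms) (auto intro!: mult_right_mono)
  have eq: "u * u powr \<alpha> = u powr (\<alpha> + 1)" if "u > 0" for u
    using powr_shift[of u "\<alpha> + 1"] that by simp
  have "(LINT u:{0<..}|lborel. (1 + (a + 1) * u) * exp (- u) * u powr (\<alpha> - 1) - b / 2 * (exp (- u) * u powr (\<alpha> + 2 - 1)))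
     = Gamma \<alpha> * (1 + (a + 1) * \<alpha>) - b / 2 * Gamma (\<alpha> + 2)"
    using set_integrable_linear_Gamma[OF assms(1), of "a + 1"] set_integrable_Gamma_integral[of "\<alpha> + 2"] assms(1)
    by (subst set_integral_diff) auto
  also have "Gamma (\<alpha> + 2) = Gamma \<alpha> * (\<alpha> * (\<alpha> + 1))"
    using Gamma_real_plus1[of "\<alpha> + 1"] Gamma_real_plus1[of \<alpha>] assms(1) by (simp add: add.assoc)
  finally have eq2: "(LINT u:{0<..}|lborel. (1 + (a + 1) * u) * exp (- u) * u powr (\<alpha> - 1) - b / 2 * (exp (- u) * u powr (\<alpha> + 2 - 1)))
     = Gamma \<alpha> * (1 + (a + 1) * \<alpha>) - b / 2 * (Gamma \<alpha> * (\<alpha> * (\<alpha> + 1)))" .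
  have "Gamma \<alpha> * (1 + (a + 1) * \<alpha> - b / 2 * (\<alpha> * (\<alpha> + 1))) =
    (LINT u:{0<..}|lborel. (1 + (a + 1) * u) * exp (- u) * u powr (\<alpha> - 1) - b / 2 * (exp (- u) * u powr (\<alpha> + 2 - 1)))"
    unfolding eq2 by (simp add: algebra_simps)
  also have "\<dots> \<le> gauss_mellin a b \<alpha>"
    unfolding gauss_mellin_def
  proof (rule set_integral_mono[OF _ int])
    show "set_integrable lborel {0<..} (\<lambda>u. (1 + (a + 1) * u) * exp (- u) * u powr (\<alpha> - 1) - b / 2 * (exp (- u) * u powr (\<alpha> + 2 - 1)))"
      using set_integrable_linear_Gamma[OF assms(1), of "a + 1"] set_integrable_Gamma_integral[of "\<alpha> + 2"] assms(1)
      by (intro set_integral_diff set_integrable_mult_right) auto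
    fix u :: real assume "u \<in> {0<..}"
    then have u: "u > 0" by simp
    have "u powr (\<alpha> + 2 - 1) = u\<^sup>2 * u powr (\<alpha> - 1)"
      using powr_shift[OF u, of \<alpha>] eq[OF u] by (simp add: power2_eq_square mult.assoc add.commute)
    then have "(1 + (a + 1) * u) * exp (- u) * u powr (\<alpha> - 1) - b / 2 * (exp (- u) * u powr (\<alpha> + 2 - 1)) =
       (1 + ((a + 1) * u - u\<^sup>2 / 2 * b)) * exp (- u) * u powr (\<alpha> - 1)" by (simp add: algebra_simps)
    also have "\<dots> \<le> exp ((a + 1) * u - u\<^sup>2 / 2 * b) * exp (- u) * u powr (\<alpha> - 1)"
      by (intro mult_right_mono exp_ge_add_one_self) auto
    also have "\<dots> = exp (u * a - u\<^sup>2 / 2 * b) * u powr (\<alpha> - 1)"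
      by (simp add: algebra_simps flip: exp_add)
    finally show "(1 + (a + 1) * u) * exp (- u) * u powr (\<alpha> - 1) - b / 2 * (exp (- u) * u powr (\<alpha> + 2 - 1))
       \<le> exp (u * a - u\<^sup>2 / 2 * b) * u powr (\<alpha> - 1)" .
  qed
  finally show "Gamma \<alpha> * (1 + (a + 1) * \<alpha> - b / 2 * (\<alpha> * (\<alpha> + 1))) \<le> gauss_mellin a b \<alpha>" .
qed

lemma gauss_mellin_pos:
  assumes "\<alpha> > 0" "b > 0"
  shows "gauss_mellin a b \<alpha> > 0"
proof -
  have "gauss_mellin a b \<alpha> \<noteq> 0"
  proof
    assume "gauss_mellin a b \<alpha> = 0"
    then have "AE u in lborel. indicator {0<..} u * (exp (u * a - u\<^sup>2 / 2 * b) * u powr (\<alpha> - 1)) = 0"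
      using set_integrable_gauss_mellin[OF assms, of a]
      unfolding gauss_mellin_def set_lebesgue_integral_def set_integrable_def
      by (subst (asm) integral_nonneg_eq_0_iff_AE) auto
    then have "AE u in lborel. u \<notin> {0<..<1::real}"
      by eventually_elim (auto simp: indicator_def)
    then have "emeasure lborel {0<..<1::real} = 0"
      by (subst (asm) AE_iff_measurable[of "{0<..<1}"]) auto
    then show False by simp
  qed
  moreover have "gauss_mellin a b \<alpha> \<ge> 0"
    unfolding gauss_mellin_def set_lebesgue_integral_def by (intro integral_nonneg_AE AE_I2) (auto simp: indicator_def)
  ultimately show ?thesis by simp
qed

text \<open>As \<alpha> decreases to 0 both integrals diverge because of u^(\<alpha> - 1) at u = 0,
  where both weights equal 1. This is what excludes a loss of mass at plus infinity in the
  limit.\<close>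

lemma Gamma_over_gauss_mellin_at_0:
  assumes "b > 0"
  shows "((\<lambda>\<alpha>. Gamma \<alpha> / gauss_mellin a b \<alpha>) \<longlongrightarrow> 1) (at_right 0)"
proof -
  obtain K where K: "K \<ge> 0" "\<And>u. u > 0 \<Longrightarrow> exp (u * a - u\<^sup>2 / 2 * b) \<le> (1 + K * u) * exp (- u)"
    using gauss_exponential_bound[OF assms] by metis
  have ev: "eventually (\<lambda>\<alpha>::real. \<alpha> > 0) (at_right 0)" by (rule eventually_at_right_less)
  have "((\<lambda>\<alpha>. gauss_mellin a b \<alpha> / Gamma \<alpha>) \<longlongrightarrow> 1) (at_right 0)"
  proof (rule tendsto_sandwich)
    show "eventually (\<lambda>\<alpha>. 1 + (a + 1) * \<alpha> - b / 2 * (\<alpha> * (\<alpha> + 1)) \<le> gauss_mellin a b \<alpha> / Gamma \<alpha>) (at_right 0)"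
      using ev by eventually_elim (use gauss_mellin_Gamma_bounds(2)[OF _ assms K(2)] in \<open>simp add: pos_le_divide_eq Gamma_real_pos mult.commute\<close>)
    show "eventually (\<lambda>\<alpha>. gauss_mellin a b \<alpha> / Gamma \<alpha> \<le> 1 + K * \<alpha>) (at_right 0)"
      using ev by eventually_elim (use gauss_mellin_Gamma_bounds(1)[OF _ assms K(2)] in \<open>simp add: pos_divide_le_eq Gamma_real_pos mult.commute\<close>)
    have "((\<lambda>\<alpha>. 1 + (a + 1) * \<alpha> - b / 2 * (\<alpha> * (\<alpha> + 1))) \<longlongrightarrow> 1 + (a + 1) * 0 - b / 2 * (0 * (0 + 1))) (at_right 0)"
      by (intro tendsto_intros)
    then show "((\<lambda>\<alpha>. 1 + (a + 1) * \<alpha> - b / 2 * (\<alpha> * (\<alpha> + 1))) \<longlongrightarrow> 1) (at_right 0)" by simp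
    have "((\<lambda>\<alpha>. 1 + K * \<alpha>) \<longlongrightarrow> 1 + K * 0) (at_right 0)" by (intro tendsto_intros)
    then show "((\<lambda>\<alpha>. 1 + K * \<alpha>) \<longlongrightarrow> 1) (at_right 0)" by simp
  qed
  from tendsto_inverse[OF this] show ?thesis by (simp only: inverse_divide inverse_1)
qed

text \<open>Gamma k / k! is only 1 / k, and the lower bound of the Mellin transform with
  \<open>R = t\<close> absorbs the power of \<open>t\<close>. What remains is a constant over
  k.\<close>

lemma Gamma_over_gauss_mellin_growth:
  assumes "b > 0" "t > 0"
  shows "(\<lambda>k. t ^ k * (Gamma (real k) / gauss_mellin a b (real k)) / fact k) \<longlonglongrightarrow> 0"
proof -
  obtain c where c: "c > 0" "\<And>\<alpha>. \<alpha> \<ge> 1 \<Longrightarrow> c * t powr (\<alpha> - 1) \<le> gauss_mellin a b \<alpha>"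
    using gauss_mellin_lower_bound[of b t a] assms by auto
  show ?thesis
  proof (rule Lim_null_comparison)
    show "eventually (\<lambda>k. norm (t ^ k * (Gamma (real k) / gauss_mellin a b (real k)) / fact k) \<le> t / c / real k) sequentially"
    proof (intro eventually_sequentiallyI[of 1])
      fix k :: nat assume k: "1 \<le> k"
      then obtain j where j: "k = Suc j" by (cases k) auto
      have low: "c * t ^ j \<le> gauss_mellin a b (real k)"
        using c(2)[of "real k"] powr_realpow[OF assms(2), of j] by (simp add: j)
      have pos: "gauss_mellin a b (real k) > 0" using gauss_mellin_pos assms k by simp
      have "Gamma (real k) / fact k = 1 / real k"
        using Gamma_fact[of j, where 'a = real] unfolding j by (simp add: add.commute)
      moreover have "t ^ k * (Gamma (real k) / gauss_mellin a b (real k)) / fact k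
          = t ^ k / gauss_mellin a b (real k) * (Gamma (real k) / fact k)" by simp
      ultimately have "norm (t ^ k * (Gamma (real k) / gauss_mellin a b (real k)) / fact k) = t * t ^ j / gauss_mellin a b (real k) / real k"
        using pos assms by (simp add: j abs_mult)
      also have "\<dots> \<le> t * t ^ j / (c * t ^ j) / real k"
        using low c assms by (intro divide_right_mono divide_left_mono) (auto intro!: mult_pos_pos gauss_mellin_pos simp: j)
      also have "\<dots> = t / c / real k" using assms c by simp
      finally show "norm (t ^ k * (Gamma (real k) / gauss_mellin a b (real k)) / fact k) \<le> t / c / real k" .
    qed
    show "(\<lambda>k. t / c / real k) \<longlonglongrightarrow> 0" by (rule lim_const_over_n)
  qed
qed

section \<open>Eigenfunctions of the Engset generator\<close>

text \<open>The kernel has one factor \<open>1 + \<rho> * u\<close> for each of the \<open>x\<close>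
  busy sources and one factor \<open>1 - u\<close> for each idle one. The exponent
  \<open>N - x\<close> is a natural-number difference, so the reading requires
  \<open>x \<le> N\<close>.\<close>

definition engset_eigenfunction :: "nat \<Rightarrow> real \<Rightarrow> real \<Rightarrow> nat \<Rightarrow> real" where
  "engset_eigenfunction N \<rho> \<alpha> x =
     (LINT u:{0<..<1}|lborel. (1 + \<rho> * u) ^ x * (1 - u) ^ (N - x) * u powr (\<alpha> - 1))"

lemma set_integrable_engset_eigenfunction:
  fixes \<alpha> \<rho> :: real
  assumes "\<alpha> > 0" "\<rho> \<ge> 0"
  shows "set_integrable lborel {0<..<1} (\<lambda>u. (1 + \<rho> * u) ^ x * (1 - u) ^ (N - x) * u powr (\<alpha> - 1))"
proof (rule set_integrable_bound)
  show "set_integrable lborel {0<..<1} (\<lambda>u. (1 + \<rho>) ^ x * exp 1 * (exp (- u) * u powr (\<alpha> - 1)))"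
    by (intro set_integrable_mult_right set_integrable_subset[OF set_integrable_Gamma_integral(1)[OF assms(1)]]) auto
  show "set_borel_measurable lborel {0<..<1} (\<lambda>u. (1 + \<rho> * u) ^ x * (1 - u) ^ (N - x) * u powr (\<alpha> - 1))"
    unfolding set_borel_measurable_def by measurable
  show "AE u in lborel. u \<in> {0<..<1} \<longrightarrow> norm ((1 + \<rho> * u) ^ x * (1 - u) ^ (N - x) * u powr (\<alpha> - 1)) \<le>
     norm ((1 + \<rho>) ^ x * exp 1 * (exp (- u) * u powr (\<alpha> - 1)))"
  proof (intro AE_I2 impI)
    fix u :: real assume "u \<in> {0<..<1}"
    then have u: "0 < u" "u < 1" by auto
    have "(1 + \<rho> * u) ^ x \<le> (1 + \<rho>) ^ x" using u assms by (intro power_mono) (auto intro: mult_left_le)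
    moreover have "(1 - u) ^ (N - x) \<le> exp 1 * exp (- u)"
    proof -
      have "(1 - u) ^ (N - x) \<le> 1" using u by (intro power_le_one) auto
      also have "1 \<le> exp 1 * exp (- u)" using u by (simp flip: exp_add)
      finally show ?thesis .
    qed
    ultimately have "(1 + \<rho> * u) ^ x * (1 - u) ^ (N - x) \<le> (1 + \<rho>) ^ x * (exp 1 * exp (- u))"
      using u assms by (intro mult_mono) auto
    then have "(1 + \<rho> * u) ^ x * (1 - u) ^ (N - x) * u powr (\<alpha> - 1) \<le> (1 + \<rho>) ^ x * (exp 1 * exp (- u)) * u powr (\<alpha> - 1)"
      by (intro mult_right_mono) auto
    then show "norm ((1 + \<rho> * u) ^ x * (1 - u) ^ (N - x) * u powr (\<alpha> - 1)) \<le>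
       norm ((1 + \<rho>) ^ x * exp 1 * (exp (- u) * u powr (\<alpha> - 1)))"
      using u assms by (simp add: abs_mult mult.assoc)
  qed
qed

text \<open>The gauge integral over the closed interval is the form in which the fundamental theorem
  of calculus can be applied, although the integrand may be singular at 0.\<close>

lemma has_integral_engset_eigenfunction:
  fixes \<alpha> \<rho> :: real
  assumes "\<alpha> > 0" "\<rho> \<ge> 0"
  shows "((\<lambda>u. (1 + \<rho> * u) ^ x * (1 - u) ^ (N - x) * u powr (\<alpha> - 1)) has_integral
     engset_eigenfunction N \<rho> \<alpha> x) {0..1}"
  using set_borel_integral_eq_integral[OF set_integrable_engset_eigenfunction[OF assms, of x N]]
  unfolding has_integral_Icc_iff_Ioo engset_eigenfunction_def
  by (simp add: has_integral_integral)

lemma engset_eigenfunction_pos: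
  assumes "\<alpha> > 0" "\<rho> \<ge> 0"
  shows "engset_eigenfunction N \<rho> \<alpha> x > 0"
proof -
  have "engset_eigenfunction N \<rho> \<alpha> x \<noteq> 0"
  proof
    assume "engset_eigenfunction N \<rho> \<alpha> x = 0"
    then have "AE u in lborel. indicator {0<..<1} u * ((1 + \<rho> * u) ^ x * (1 - u) ^ (N - x) * u powr (\<alpha> - 1)) = 0"
      using set_integrable_engset_eigenfunction[OF assms, of x N] assms
      unfolding engset_eigenfunction_def set_lebesgue_integral_def set_integrable_def
      by (subst (asm) integral_nonneg_eq_0_iff_AE) (auto simp: indicator_def)
    then have "AE u in lborel. u \<notin> {0<..<1::real}"
    proof eventually_elim
      case (elim u)
      have "1 + \<rho> * u > 0" if "u \<in> {0<..<1}" using that assms by (intro add_pos_nonneg) auto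
      with elim show ?case by (auto simp: indicator_def)
    qed
    then have "emeasure lborel {0<..<1::real} = 0"
      by (subst (asm) AE_iff_measurable[of "{0<..<1}"]) auto
    then show False by simp
  qed
  moreover have "engset_eigenfunction N \<rho> \<alpha> x \<ge> 0"
    unfolding engset_eigenfunction_def set_lebesgue_integral_def using assms
    by (intro integral_nonneg_AE AE_I2) (auto simp: indicator_def)
  ultimately show ?thesis by simp
qed

text \<open>Put \<open>F x = (1 + \<rho> u) ^ x * (1 - u) ^ (N - x)\<close>. The generator maps \<open>F\<close> to
  \<open>- u * dF/du\<close>, so that an integration by parts against \<open>u powr (\<alpha> - 1)\<close> produces the factor \<open>\<alpha>\<close>.\<close>

lemma engset_eigenfunction_generator:
  assumes \<alpha>: "\<alpha> > 0" and par: "\<mu> > 0" "\<nu> > 0" "\<mu> + \<nu> = 1" and x: "x < N"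
  defines "f \<equiv> engset_eigenfunction N (\<mu> / \<nu>) \<alpha>"
  shows "\<nu> * (real N - real x) * (f (x + 1) - f x) + \<mu> * real x * (f (x - 1) - f x) = \<alpha> * f x"
proof -
  define \<rho> where "\<rho> = \<mu> / \<nu>"
  have \<rho>: "\<rho> \<ge> 0" "\<nu> * \<rho> = \<mu>" "\<nu> * (1 + \<rho>) = 1" using par by (auto simp: \<rho>_def field_simps)
  define F where "F y u = (1 + \<rho> * u) ^ y * (1 - u) ^ (N - y)" for y and u :: real
  define dF where "dF u = real x * (\<rho> * (1 + \<rho> * u) ^ (x - 1)) * (1 - u) ^ (N - x)
      - (1 + \<rho> * u) ^ x * (real (N - x) * (1 - u) ^ (N - x - 1))" for u :: real
  have hi: "((\<lambda>u. F y u * u powr (\<alpha> - 1)) has_integral f y) {0..1}" for y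
    unfolding F_def f_def \<rho>_def[symmetric] by (rule has_integral_engset_eigenfunction[OF \<alpha> \<rho>(1)])
  \<comment> \<open>The normalisation \<mu> + \<nu> = 1 enters as \<nu> (1 + \<rho>) = 1: exchanging
    an idle source for a busy one changes its factor by (1 + \<rho>) u.\<close>
  have up: "\<nu> * (F (x + 1) u - F x u) = u * ((1 + \<rho> * u) ^ x * (1 - u) ^ (N - x - 1))" for u
  proof -
    define m where "m = N - x - 1"
    have m: "N - x = Suc m" "N - (x + 1) = m" using x by (auto simp: m_def)
    have "F (x + 1) u - F x u = (1 + \<rho>) * u * ((1 + \<rho> * u) ^ x * (1 - u) ^ m)"
      unfolding F_def m by (simp add: algebra_simps)
    then have "\<nu> * (F (x + 1) u - F x u) = \<nu> * (1 + \<rho>) * (u * ((1 + \<rho> * u) ^ x * (1 - u) ^ m))" by simp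
    then show ?thesis unfolding \<rho>(3) m_def by simp
  qed
  have down: "\<nu> * (F (x - 1) u - F x u) = - u * ((1 + \<rho> * u) ^ (x - 1) * (1 - u) ^ (N - x))" if "x > 0" for u
  proof -
    define m where "m = x - 1"
    define k where "k = N - x"
    have m: "x = Suc m" "x - 1 = m" "N - m = Suc k" using x that by (auto simp: m_def k_def)
    have "F (x - 1) u - F x u = - ((1 + \<rho>) * u * ((1 + \<rho> * u) ^ m * (1 - u) ^ k))"
      unfolding F_def m(2,3) k_def[symmetric] unfolding m(1) by (simp add: algebra_simps)
    then have "\<nu> * (F (x - 1) u - F x u) = \<nu> * (1 + \<rho>) * (- (u * ((1 + \<rho> * u) ^ m * (1 - u) ^ k)))" by simp
    then show ?thesis unfolding \<rho>(3) m_def k_def by simp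
  qed
  have gen: "\<nu> * (real N - real x) * (F (x + 1) u - F x u) + \<mu> * real x * (F (x - 1) u - F x u) = - u * dF u" for u
  proof -
    have "\<nu> * (real N - real x) * (F (x + 1) u - F x u) = (real N - real x) * (\<nu> * (F (x + 1) u - F x u))" by simp
    also have "\<dots> = u * ((1 + \<rho> * u) ^ x * (real (N - x) * (1 - u) ^ (N - x - 1)))"
      unfolding up using x by (simp add: of_nat_diff)
    finally have 1: "\<nu> * (real N - real x) * (F (x + 1) u - F x u) = \<dots>" .
    \<comment> \<open>For \<open>x = 0\<close> the truncated difference \<open>x - 1\<close> is 0
      again, which is harmless since the downward rate vanishes there.\<close>
    have 2: "\<mu> * real x * (F (x - 1) u - F x u) = - u * (real x * (\<rho> * (1 + \<rho> * u) ^ (x - 1)) * (1 - u) ^ (N - x))"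
    proof (cases "x = 0")
      case False
      have "\<mu> * real x * (F (x - 1) u - F x u) = \<rho> * real x * (\<nu> * (F (x - 1) u - F x u))"
        unfolding \<rho>(2)[symmetric] by simp
      also have "\<dots> = - u * (real x * (\<rho> * (1 + \<rho> * u) ^ (x - 1)) * (1 - u) ^ (N - x))"
        using down False by simp
      finally show ?thesis .
    qed simp
    show ?thesis unfolding 1 2 dF_def by (simp add: right_diff_distrib)
  qed
  \<comment> \<open>No boundary terms survive: the power vanishes at 0, and \<open>x < N\<close>
    leaves at least one factor 1 - u at 1.\<close>
  have F0: "u powr \<alpha> * F x u = 0" if "u = 0 \<or> u = 1" for u
    using that x by (auto simp: F_def)
  have der: "((\<lambda>u. u powr \<alpha> * F x u) has_vector_derivative
      \<alpha> * (F x u * u powr (\<alpha> - 1)) - (- u * dF u) * u powr (\<alpha> - 1)) (at u)" if "u \<in> {0<..<1}" for u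
  proof -
    have "(F x has_real_derivative dF u) (at u)"
      unfolding F_def dF_def by (auto intro!: derivative_eq_intros)
    then have "((\<lambda>u. u powr \<alpha> * F x u) has_real_derivative \<alpha> * u powr (\<alpha> - 1) * F x u + u powr \<alpha> * dF u) (at u)"
      using that by (auto intro!: derivative_eq_intros)
    moreover have "\<alpha> * u powr (\<alpha> - 1) * F x u + u powr \<alpha> * dF u = \<alpha> * (F x u * u powr (\<alpha> - 1)) - (- u * dF u) * u powr (\<alpha> - 1)"
      using that powr_shift[of u \<alpha>] by (simp add: algebra_simps)
    ultimately show ?thesis by (simp add: has_real_derivative_iff_has_vector_derivative)
  qed
  have int1: "((\<lambda>u. \<alpha> * (F x u * u powr (\<alpha> - 1)) - (- u * dF u) * u powr (\<alpha> - 1)) has_integral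
      1 powr \<alpha> * F x 1 - 0 powr \<alpha> * F x 0) {0..1}"
  proof (rule fundamental_theorem_of_calculus_interior)
    show "continuous_on {0..1} (\<lambda>u. u powr \<alpha> * F x u)"
    proof (rule continuous_on_mult)
      show "continuous_on {0..1} (\<lambda>u::real. u powr \<alpha>)"
        using \<alpha> by (intro continuous_on_powr' continuous_on_id continuous_on_const) auto
      show "continuous_on {0..1} (F x)" unfolding F_def by (intro continuous_intros)
    qed
  qed (use der in auto)
  have int2: "((\<lambda>u. \<alpha> * (F x u * u powr (\<alpha> - 1)) - (\<nu> * (real N - real x) * (F (x + 1) u * u powr (\<alpha> - 1) - F x u * u powr (\<alpha> - 1))
        + \<mu> * real x * (F (x - 1) u * u powr (\<alpha> - 1) - F x u * u powr (\<alpha> - 1)))) has_integral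
     \<alpha> * f x - (\<nu> * (real N - real x) * (f (x + 1) - f x) + \<mu> * real x * (f (x - 1) - f x))) {0..1}"
    by (intro has_integral_diff has_integral_add has_integral_mult_right hi)
  have gen2: "\<nu> * (real N - real x) * (F (x + 1) u * u powr (\<alpha> - 1) - F x u * u powr (\<alpha> - 1))
        + \<mu> * real x * (F (x - 1) u * u powr (\<alpha> - 1) - F x u * u powr (\<alpha> - 1)) = (- u * dF u) * u powr (\<alpha> - 1)" for u
    unfolding gen[symmetric]
    by (simp only: left_diff_distrib[symmetric] mult.assoc[symmetric] distrib_right[symmetric])
  have "\<alpha> * f x - (\<nu> * (real N - real x) * (f (x + 1) - f x) + \<mu> * real x * (f (x - 1) - f x))
     = 1 powr \<alpha> * F x 1 - 0 powr \<alpha> * F x 0"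
    using int2 unfolding gen2 by (rule has_integral_unique[OF _ int1])
  then show ?thesis using F0[of 0] F0[of 1] by simp
qed

text \<open>Below \<open>C\<close> the truncated rates agree with those of the unrestricted system,
  so the eigenvalue equation carries over; the blocked upward jump concerns only the excluded state
  \<open>C\<close>.\<close>

lemma engset_rate_eigenvector:
  assumes \<alpha>: "\<alpha> > 0" and par: "\<mu> > 0" "\<nu> > 0" "\<mu> + \<nu> = 1" and C: "C \<le> N" and x: "x \<in> {0..C} - {C}"
  defines "f \<equiv> engset_eigenfunction N (\<mu> / \<nu>) \<alpha>"
  shows "(\<Sum>y\<in>{0..C} - {x}. engset_rate N C \<nu> \<mu> x y * (f y - f x)) = \<alpha> * f x"
proof -
  have xC: "x < C" using x by auto
  have "(\<Sum>y\<in>{0..C} - {x}. engset_rate N C \<nu> \<mu> x y * (f y - f x))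
      = (\<Sum>y\<in>{0..C} - {x}. (if y = x + 1 then \<nu> * (real N - real x) * (f (x + 1) - f x) else 0)
          + (if x > 0 \<and> y = x - 1 then \<mu> * real x * (f (x - 1) - f x) else 0))"
    using xC by (intro sum.cong) (auto simp: engset_rate_def)
  also have "\<dots> = \<nu> * (real N - real x) * (f (x + 1) - f x) + \<mu> * real x * (f (x - 1) - f x)"
    using xC by (cases "x = 0") (auto simp: sum.distrib)
  also have "\<dots> = \<alpha> * f x"
    unfolding f_def using xC C by (intro engset_eigenfunction_generator \<alpha> par) auto
  finally show ?thesis .
qed

text \<open>The eigenfunctions themselves blow up as \<alpha> tends to 0, but their ratios satisfy
  the same second-order recursion. At \<alpha> = 0 that recursion propagates the constant 1
  upwards.\<close>

lemma engset_eigenfunction_ratio_at_0: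
  assumes par: "\<mu> > 0" "\<nu> > 0" "\<mu> + \<nu> = 1" and x: "x \<le> N"
  shows "((\<lambda>\<alpha>. engset_eigenfunction N (\<mu> / \<nu>) \<alpha> x / engset_eigenfunction N (\<mu> / \<nu>) \<alpha> 0) \<longlongrightarrow> 1) (at_right 0)"
  using x
proof (induction x rule: less_induct)
  case (less x)
  define r where "r y \<alpha> = engset_eigenfunction N (\<mu> / \<nu>) \<alpha> y / engset_eigenfunction N (\<mu> / \<nu>) \<alpha> 0" for y \<alpha>
  have pos: "engset_eigenfunction N (\<mu> / \<nu>) \<alpha> y > 0" if "\<alpha> > 0" for \<alpha> y
    using engset_eigenfunction_pos that par by simp
  have ev: "eventually (\<lambda>\<alpha>::real. \<alpha> > 0) (at_right 0)" by (rule eventually_at_right_less)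
  show ?case
  proof (cases x)
    case 0
    show ?thesis unfolding 0
      by (rule tendsto_eventually, use ev in eventually_elim) (metis divide_self less_numeral_extra(3) pos)
  next
    case (Suc y)
    have IH: "(r y \<longlongrightarrow> 1) (at_right 0)" "(r (y - 1) \<longlongrightarrow> 1) (at_right 0)"
      using less Suc unfolding r_def by auto
    define c where "c = \<nu> * (real N - real y)"
    have c: "c > 0" using less Suc par by (simp add: c_def)
    \<comment> \<open>The eigenvalue equation at \<open>y\<close> is solved for the value at
      \<open>x = y + 1\<close>; the coefficient \<open>c\<close> is nonzero because
      \<open>y < N\<close>.\<close>
    have "((\<lambda>\<alpha>. (\<alpha> * r y \<alpha> - \<mu> * real y * (r (y - 1) \<alpha> - r y \<alpha>)) / c + r y \<alpha>) \<longlongrightarrow>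
       (0 * 1 - \<mu> * real y * (1 - 1)) / c + 1) (at_right 0)"
      using c by (intro tendsto_intros IH) auto
    then have "((\<lambda>\<alpha>. (\<alpha> * r y \<alpha> - \<mu> * real y * (r (y - 1) \<alpha> - r y \<alpha>)) / c + r y \<alpha>) \<longlongrightarrow> 1) (at_right 0)" by simp
    moreover have "eventually (\<lambda>\<alpha>. (\<alpha> * r y \<alpha> - \<mu> * real y * (r (y - 1) \<alpha> - r y \<alpha>)) / c + r y \<alpha> = r x \<alpha>) (at_right 0)"
      using ev
    proof eventually_elim
      case (elim \<alpha>)
      define e where "e = engset_eigenfunction N (\<mu> / \<nu>) \<alpha>"
      have "c * (e x - e y) + \<mu> * real y * (e (y - 1) - e y) = \<alpha> * e y"
        using engset_eigenfunction_generator[OF elim par, of y N] less Suc by (simp add: c_def e_def)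
      then have "(c * (e x - e y) + \<mu> * real y * (e (y - 1) - e y)) / e 0 = \<alpha> * e y / e 0" by simp
      then have "c * (r x \<alpha> - r y \<alpha>) + \<mu> * real y * (r (y - 1) \<alpha> - r y \<alpha>) = \<alpha> * r y \<alpha>"
        unfolding r_def e_def[symmetric] by (simp add: add_divide_distrib diff_divide_distrib right_diff_distrib)
      then have "\<alpha> * r y \<alpha> - \<mu> * real y * (r (y - 1) \<alpha> - r y \<alpha>) = c * (r x \<alpha> - r y \<alpha>)" by simp
      then show ?case using c by simp
    qed
    ultimately have "(r x \<longlongrightarrow> 1) (at_right 0)" by (rule Lim_transform_eventually)
    then show ?thesis by (simp add: r_def[abs_def])
  qed
qed

section \<open>Asymptotics of the eigenfunctions\<close>

lemma mellin_scaling: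
  fixes g :: "real \<Rightarrow> real"
  assumes s: "s > 0"
  shows "s powr \<alpha> * (LINT u:{0<..<1}|lborel. g u * u powr (\<alpha> - 1)) =
     (LINT w:{0<..<s}|lborel. g (w / s) * w powr (\<alpha> - 1))"
proof -
  have "(LINT u:{0<..<1}|lborel. g u * u powr (\<alpha> - 1)) =
      (1 / s) * (LINT w|lborel. indicator {0<..<1} (w / s) * (g (w / s) * (w / s) powr (\<alpha> - 1)))"
    unfolding set_lebesgue_integral_def using s
    by (subst lborel_integral_real_affine[where c = "1 / s" and t = 0]) auto
  also have "(\<lambda>w. indicator {0<..<1} (w / s) * (g (w / s) * (w / s) powr (\<alpha> - 1))) =
      (\<lambda>w. (indicator {0<..<s} w * (g (w / s) * w powr (\<alpha> - 1))) * (s / s powr \<alpha>))"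
  proof
    fix w :: real
    show "indicator {0<..<1} (w / s) * (g (w / s) * (w / s) powr (\<alpha> - 1)) =
        (indicator {0<..<s} w * (g (w / s) * w powr (\<alpha> - 1))) * (s / s powr \<alpha>)"
    proof (cases "0 < w \<and> w < s")
      case True
      then have "(w / s) powr (\<alpha> - 1) = w powr (\<alpha> - 1) * (s / s powr \<alpha>)"
        using s by (simp add: powr_divide powr_diff)
      then show ?thesis using True s by (simp add: indicator_def)
    next
      case False
      then show ?thesis using s by (auto simp: indicator_def zero_less_divide_iff)
    qed
  qed
  also have "(LINT w|lborel. (indicator {0<..<s} w * (g (w / s) * w powr (\<alpha> - 1))) * (s / s powr \<alpha>)) =
      (LINT w:{0<..<s}|lborel. g (w / s) * w powr (\<alpha> - 1)) * (s / s powr \<alpha>)"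
    unfolding set_lebesgue_integral_def by (simp only: real_scaleR_def integral_mult_left_zero)
  finally show ?thesis using s by simp
qed

lemma mellin_dominated_convergence:
  fixes g :: "nat \<Rightarrow> real \<Rightarrow> real" and s :: "nat \<Rightarrow> real"
  assumes s: "filterlim s at_top sequentially"
    and meas: "\<And>n. g n \<in> borel_measurable borel" "G \<in> borel_measurable borel"
    and dom: "set_integrable lborel {0<..} (\<lambda>w. D w * w powr (\<alpha> - 1))"
    and bound: "eventually (\<lambda>n. \<forall>w. 0 < w \<longrightarrow> w < s n \<longrightarrow> \<bar>g n (w / s n)\<bar> \<le> D w) sequentially"
    and lim: "\<And>w. w > 0 \<Longrightarrow> (\<lambda>n. g n (w / s n)) \<longlonglongrightarrow> G w"
  shows "(\<lambda>n. s n powr \<alpha> * (LINT u:{0<..<1}|lborel. g n u * u powr (\<alpha> - 1))) \<longlonglongrightarrow>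
     (LINT w:{0<..}|lborel. G w * w powr (\<alpha> - 1))"
proof -
  note [measurable] = meas
  have "eventually (\<lambda>n. s n > 0) sequentially" using s by (simp add: filterlim_at_top_dense)
  with bound have "eventually (\<lambda>n. s n > 0 \<and> (\<forall>w. 0 < w \<longrightarrow> w < s n \<longrightarrow> \<bar>g n (w / s n)\<bar> \<le> D w)) sequentially"
    by eventually_elim blast
  then obtain n0 where n0: "\<And>n. n \<ge> n0 \<Longrightarrow> s n > 0"
    "\<And>n w. n \<ge> n0 \<Longrightarrow> 0 < w \<Longrightarrow> w < s n \<Longrightarrow> \<bar>g n (w / s n)\<bar> \<le> D w"
    unfolding eventually_sequentially by blast
  \<comment> \<open>Shifting the index by \<open>n0\<close> makes the domination valid for every
    term; the shift is undone at the end.\<close>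
  define h where "h n w = indicator {0<..<s (n + n0)} w * (g (n + n0) (w / s (n + n0)) * w powr (\<alpha> - 1))" for n w
  have "(\<lambda>n. LINT w|lborel. h n w) \<longlonglongrightarrow> (LINT w|lborel. indicator {0<..} w * (G w * w powr (\<alpha> - 1)))"
  proof (rule integral_dominated_convergence)
    show "integrable lborel (\<lambda>w. indicator {0<..} w * (D w * w powr (\<alpha> - 1)))"
      using dom by (simp add: set_integrable_def)
    show "h n \<in> borel_measurable lborel" for n unfolding h_def by measurable
    show "AE w in lborel. (\<lambda>n. h n w) \<longlonglongrightarrow> indicator {0<..} w * (G w * w powr (\<alpha> - 1))"
    proof (intro AE_I2)
      fix w :: real
      show "(\<lambda>n. h n w) \<longlonglongrightarrow> indicator {0<..} w * (G w * w powr (\<alpha> - 1))"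
      proof (cases "w > 0")
        case True
        have "eventually (\<lambda>n. s n > w) sequentially" using s by (simp add: filterlim_at_top_dense)
        then have "eventually (\<lambda>n. s (n + n0) > w) sequentially" by (rule eventually_all_ge_at_top[THEN eventually_mono]) auto
        then have "eventually (\<lambda>n. g (n + n0) (w / s (n + n0)) * w powr (\<alpha> - 1) = h n w) sequentially"
          by eventually_elim (use True in \<open>simp add: h_def\<close>)
        moreover have "(\<lambda>n. g (n + n0) (w / s (n + n0)) * w powr (\<alpha> - 1)) \<longlonglongrightarrow> G w * w powr (\<alpha> - 1)"
          by (intro tendsto_mult tendsto_const LIMSEQ_ignore_initial_segment[OF lim[OF True]])
        ultimately have "(\<lambda>n. h n w) \<longlonglongrightarrow> G w * w powr (\<alpha> - 1)"
          by (rule Lim_transform_eventually[rotated])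
        then show ?thesis using True by simp
      qed (simp add: h_def)
    qed
    show "AE w in lborel. norm (h n w) \<le> indicator {0<..} w * (D w * w powr (\<alpha> - 1))" for n
    proof (intro AE_I2)
      fix w :: real
      have "D w \<ge> 0" if "0 < w" "w < s (n + n0)" using n0(2)[of "n + n0" w] that by linarith
      \<comment> \<open>Nonnegativity of \<open>D\<close> follows from the bound itself: each
        \<open>w\<close> is eventually below \<open>s n\<close>, and there \<open>D w\<close>
        dominates an absolute value.\<close>
      moreover have "D w \<ge> 0" if "w > 0"
      proof -
        have "eventually (\<lambda>n. s n > w \<and> n \<ge> n0) sequentially"
          using s by (intro eventually_conj eventually_ge_at_top) (simp add: filterlim_at_top_dense)
        then obtain n where "s n > w" "n \<ge> n0"
          using eventually_happens trivial_limit_sequentially by blast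
        with n0(2)[of n w] that show ?thesis by linarith
      qed
      ultimately show "norm (h n w) \<le> indicator {0<..} w * (D w * w powr (\<alpha> - 1))"
        using n0(2)[of "n + n0" w] by (auto simp: h_def indicator_def abs_mult intro!: mult_right_mono)
    qed
  qed auto
  then have "(\<lambda>n. s (n + n0) powr \<alpha> * (LINT u:{0<..<1}|lborel. g (n + n0) u * u powr (\<alpha> - 1))) \<longlonglongrightarrow>
     (LINT w:{0<..}|lborel. G w * w powr (\<alpha> - 1))"
    using n0(1) by (subst mellin_scaling) (auto simp: h_def set_lebesgue_integral_def)
  then show ?thesis by (rule LIMSEQ_offset)
qed

text \<open>In the empty state the kernel is (1 - u)^N, which lives on u of order 1/N; hence the
  scale N rather than its square root.\<close>

lemma engset_eigenfunction_0_asymptotics: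
  assumes "\<alpha> > 0"
  shows "(\<lambda>N. real N powr \<alpha> * engset_eigenfunction N \<rho> \<alpha> 0) \<longlonglongrightarrow> Gamma \<alpha>"
  unfolding engset_eigenfunction_def set_integrable_Gamma_integral(2)[OF assms, symmetric] power_0 mult_1 diff_zero
proof (rule mellin_dominated_convergence[where D = "\<lambda>w. exp (- w)"])
  show "set_integrable lborel {0<..} (\<lambda>w. exp (- w) * w powr (\<alpha> - 1))"
    by (rule set_integrable_Gamma_integral[OF assms])
  show "filterlim real at_top sequentially" by (rule filterlim_real_sequentially)
  show "(\<lambda>N. (1 - w / real N) ^ N) \<longlonglongrightarrow> exp (- w)" for w :: real
    using tendsto_exp_limit_sequentially[of "- w"] by simp
  show "eventually (\<lambda>N. \<forall>w. 0 < w \<longrightarrow> w < real N \<longrightarrow> \<bar>(1 - w / real N) ^ N\<bar> \<le> exp (- w)) sequentially"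
  proof (intro always_eventually allI impI)
    fix N :: nat and w :: real assume w: "0 < w" "w < real N"
    have "(1 - w / real N) ^ N \<le> exp (- (w / real N)) ^ N"
      using w exp_ge_add_one_self[of "- (w / real N)"] by (intro power_mono) auto
    also have "\<dots> = exp (- w)" using w by (simp flip: exp_of_nat_mult)
    finally show "\<bar>(1 - w / real N) ^ N\<bar> \<le> exp (- w)" using w by (simp add: abs_of_nonneg)
  qed
qed measurable

text \<open>At the critical scale the linear terms of busy and idle sources nearly cancel, so a
  bound by exp (- z) would give no decay. The quadratic term of the idle sources supplies the
  Gaussian tail of the majorant.\<close>

lemma one_minus_le_exp_quadratic:
  fixes z :: real
  assumes "0 \<le> z" "z < 1"
  shows "1 - z \<le> exp (- z - z\<^sup>2 / 2)"
proof -
  have "(- 0 - 0\<^sup>2 / 2 - ln (1 - 0)) \<le> (- z - z\<^sup>2 / 2 - ln (1 - z) :: real)"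
  proof (rule DERIV_nonneg_imp_nondecreasing[OF assms(1)])
    fix x :: real assume x: "0 \<le> x" "x \<le> z"
    have "((\<lambda>z. - z - z\<^sup>2 / 2 - ln (1 - z)) has_real_derivative x\<^sup>2 / (1 - x)) (at x)"
      using x assms by (auto intro!: derivative_eq_intros simp: field_simps power2_eq_square)
    moreover have "x\<^sup>2 / (1 - x) \<ge> 0" using x assms by simp
    ultimately show "\<exists>y. ((\<lambda>z. - z - z\<^sup>2 / 2 - ln (1 - z)) has_real_derivative y) (at x) \<and> 0 \<le> y" by blast
  qed
  then have "exp (ln (1 - z)) \<le> exp (- z - z\<^sup>2 / 2)" by simp
  then show ?thesis using assms by simp
qed

text \<open>Put u = w / sqrt N and expand the logarithm of the kernel. Since C N is within O(sqrt N)
  of \<nu> N, the linear coefficient is of order sqrt N and yields w \<delta> / \<nu>, while the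
  quadratic coefficient is asymptotic to \<rho> N and yields the Gaussian term.\<close>

lemma engset_eigenfunction_critical_asymptotics:
  fixes C :: "nat \<Rightarrow> nat"
  assumes \<alpha>: "\<alpha> > 0" and par: "\<mu> > 0" "\<nu> > 0" "\<mu> + \<nu> = 1"
    and C: "\<And>N. N \<ge> 1 \<Longrightarrow> C N \<le> N"
    and crit: "(\<lambda>N. real (C N) - (\<nu> * real N + \<delta> * sqrt (real N))) \<in> o(\<lambda>N. sqrt (real N))"
  shows "(\<lambda>N. sqrt (real N) powr \<alpha> * engset_eigenfunction N (\<mu> / \<nu>) \<alpha> (C N)) \<longlonglongrightarrow>
     gauss_mellin (\<delta> / \<nu>) (\<mu> / \<nu>) \<alpha>"
proof -
  define \<rho> where "\<rho> = \<mu> / \<nu>"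
  have \<rho>: "\<rho> > 0" "1 + \<rho> = 1 / \<nu>" using par by (auto simp: \<rho>_def field_simps)
  define s where "s N = sqrt (real N)" for N
  have s: "filterlim s at_top sequentially"
    unfolding s_def by (rule filterlim_compose[OF sqrt_at_top filterlim_real_sequentially])
  have s2: "s N * s N = real N" for N by (simp add: s_def)
  have spos: "eventually (\<lambda>N. s N > 0) sequentially" using s by (simp add: filterlim_at_top_dense)
  define d where "d N = (real (C N) - \<nu> * real N) / s N" for N
  have d: "d \<longlonglongrightarrow> \<delta>"
  proof -
    have "(\<lambda>N. (real (C N) - (\<nu> * real N + \<delta> * s N)) / s N + \<delta>) \<longlonglongrightarrow> 0 + \<delta>"
      using smalloD_tendsto[OF crit] unfolding s_def by (intro tendsto_add tendsto_const)
    moreover have "eventually (\<lambda>N. (real (C N) - (\<nu> * real N + \<delta> * s N)) / s N + \<delta> = d N) sequentially"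
      using spos by eventually_elim (simp add: d_def field_simps)
    ultimately show ?thesis using Lim_transform_eventually by fastforce
  qed
  define c where "c N = real (C N) / real N" for N
  have c: "c \<longlonglongrightarrow> \<nu>"
  proof -
    have "(\<lambda>N. \<nu> + d N * (1 / s N)) \<longlonglongrightarrow> \<nu> + \<delta> * 0"
      by (intro tendsto_intros d tendsto_divide_0[OF tendsto_const] filterlim_at_top_imp_at_infinity s)
    moreover have "eventually (\<lambda>N. \<nu> + d N * (1 / s N) = c N) sequentially"
      using spos by eventually_elim (simp add: d_def c_def flip: s2, simp add: field_simps)
    ultimately show ?thesis using Lim_transform_eventually by fastforce
  qed
  define g where "g N u = (1 + \<rho> * u) ^ C N * (1 - u) ^ (N - C N)" for N and u :: real
  define A where "A = (\<delta> + 1) / \<nu>"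
  have linear: "real (C N) * \<rho> - real (N - C N) = d N / \<nu> * s N" if "N \<ge> 1" "s N > 0" for N
  proof -
    have "real (C N) * \<rho> - real (N - C N) = real (C N) * (1 + \<rho>) - real N"
      using C[OF that(1)] by (simp add: of_nat_diff algebra_simps)
    also have "\<dots> = (real (C N) - \<nu> * real N) / \<nu>"
      unfolding \<rho>(2) using par by (simp add: field_simps)
    also have "\<dots> = d N / \<nu> * s N" using that by (simp add: d_def)
    finally show ?thesis .
  qed
  \<comment> \<open>The two strict margins make the majorant independent of N:
    \<open>d N < \<delta> + 1\<close> explains \<open>A\<close>, and the idle fraction
    \<open>1 - c N\<close>, which tends to \<mu>, stays above \<mu> / 2.\<close>
  have dom: "eventually (\<lambda>N. \<forall>w. 0 < w \<longrightarrow> w < s N \<longrightarrow> \<bar>g N (w / s N)\<bar> \<le> exp (w * A - w\<^sup>2 / 2 * (\<mu> / 2))) sequentially"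
  proof -
    have "eventually (\<lambda>N. d N < \<delta> + 1) sequentially" by (rule order_tendstoD[OF d]) simp
    moreover have "eventually (\<lambda>N. c N < 1 - \<mu> / 2) sequentially"
      by (rule order_tendstoD[OF c]) (use par in simp)
    ultimately show ?thesis using spos eventually_ge_at_top[of 1]
    proof eventually_elim
      case (elim N)
      show ?case
      proof (intro allI impI)
        fix w assume w: "0 < w" "w < s N"
        define y where "y = w / s N"
        have y: "0 < y" "y < 1" "w = y * s N" using w by (auto simp: y_def)
        have "g N y \<le> exp (\<rho> * y) ^ C N * exp (- y - y\<^sup>2 / 2) ^ (N - C N)"
          unfolding g_def using y \<rho> exp_ge_add_one_self[of "\<rho> * y"] one_minus_le_exp_quadratic[of y]
          by (intro mult_mono power_mono) auto
        also have "\<dots> = exp ((real (C N) * \<rho> - real (N - C N)) * y - real (N - C N) * y\<^sup>2 / 2)"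
          by (simp add: algebra_simps flip: exp_of_nat_mult exp_add)
        also have "\<dots> = exp (d N / \<nu> * w - (1 - c N) * w\<^sup>2 / 2)"
        proof -
          have "real (N - C N) = (1 - c N) * (s N * s N)"
            unfolding s2 using C[OF elim(4)] elim(4) by (simp add: c_def of_nat_diff field_simps)
          then have "real (N - C N) * y\<^sup>2 / 2 = (1 - c N) * w\<^sup>2 / 2"
            unfolding y(3) by (simp add: power2_eq_square)
          moreover have "(real (C N) * \<rho> - real (N - C N)) * y = d N / \<nu> * w"
            unfolding linear[OF elim(4,3)] y(3) by simp
          ultimately show ?thesis by (simp only:)
        qed
        also have "\<dots> \<le> exp (w * A - w\<^sup>2 / 2 * (\<mu> / 2))"
        proof -
          have "d N / \<nu> * w \<le> A * w" using elim(1) par w by (intro mult_right_mono) (auto simp: A_def divide_right_mono)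
          moreover have "\<mu> / 2 * (w\<^sup>2 / 2) \<le> (1 - c N) * (w\<^sup>2 / 2)" using elim(2) by (intro mult_right_mono) auto
          ultimately show ?thesis by (simp add: mult.commute)
        qed
        finally show "\<bar>g N (w / s N)\<bar> \<le> exp (w * A - w\<^sup>2 / 2 * (\<mu> / 2))"
          using y \<rho> by (simp add: y_def[symmetric] g_def abs_mult)
      qed
    qed
  qed
  \<comment> \<open>This is the normalised second-order remainder of the logarithm. Its limit is
    taken along nonzero arguments, so \<open>k * (w / s N)\<close> is shown to be nonzero before
    composing.\<close>
  define L where "L y = (ln (1 + y) - y) / y\<^sup>2" for y :: real
  have L: "(L \<longlongrightarrow> - 1 / 2) (at 0)" unfolding L_def by real_asymp
  have lim: "(\<lambda>N. g N (w / s N)) \<longlonglongrightarrow> exp (w * (\<delta> / \<nu>) - w\<^sup>2 / 2 * \<rho>)" if w: "w > 0" for w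
  proof -
    have y0: "(\<lambda>N. w / s N) \<longlonglongrightarrow> 0"
      by (intro tendsto_divide_0[OF tendsto_const] filterlim_at_top_imp_at_infinity s)
    have L': "(\<lambda>N. L (k * (w / s N))) \<longlonglongrightarrow> - 1 / 2" if "k \<noteq> 0" for k
    proof (rule filterlim_compose[OF L])
      show "filterlim (\<lambda>N. k * (w / s N)) (at 0) sequentially"
        unfolding filterlim_at
      proof
        show "(\<lambda>N. k * (w / s N)) \<longlonglongrightarrow> 0" using tendsto_mult_right_zero[OF y0] .
        show "eventually (\<lambda>N. k * (w / s N) \<in> UNIV \<and> k * (w / s N) \<noteq> 0) sequentially"
          using spos by eventually_elim (use w that in auto)
      qed
    qed
    have "(\<lambda>N. d N / \<nu> * w + c N * w\<^sup>2 * \<rho>\<^sup>2 * L (\<rho> * (w / s N)) + (1 - c N) * w\<^sup>2 * L (- 1 * (w / s N)))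
        \<longlonglongrightarrow> \<delta> / \<nu> * w + \<nu> * w\<^sup>2 * \<rho>\<^sup>2 * (- 1 / 2) + (1 - \<nu>) * w\<^sup>2 * (- 1 / 2)"
      using \<rho>(1) par by (intro tendsto_intros d c L') auto
    also have "\<delta> / \<nu> * w + \<nu> * w\<^sup>2 * \<rho>\<^sup>2 * (- 1 / 2) + (1 - \<nu>) * w\<^sup>2 * (- 1 / 2) = w * (\<delta> / \<nu>) - w\<^sup>2 / 2 * \<rho>"
    proof -
      \<comment> \<open>Busy sources contribute the fraction \<nu> with weight \<rho>^2 and idle
        ones 1 - \<nu> with weight 1; the sum collapses because 1 - \<nu> = \<nu> \<rho>.\<close>
      have "\<nu> * \<rho>\<^sup>2 + (1 - \<nu>) = \<rho>"
      proof -
        have e: "1 - \<nu> = \<nu> * \<rho>" using par by (auto simp: \<rho>_def)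
        have "\<nu> * \<rho>\<^sup>2 + (1 - \<nu>) = \<nu> * (1 + \<rho>) * \<rho>" unfolding e by (simp add: power2_eq_square algebra_simps)
        then show ?thesis using par by (simp add: \<rho>(2))
      qed
      moreover have "\<delta> / \<nu> * w + \<nu> * w\<^sup>2 * \<rho>\<^sup>2 * (- 1 / 2) + (1 - \<nu>) * w\<^sup>2 * (- 1 / 2) =
          w * (\<delta> / \<nu>) - w\<^sup>2 / 2 * (\<nu> * \<rho>\<^sup>2 + (1 - \<nu>))" by (simp add: algebra_simps)
      ultimately show ?thesis by simp
    qed
    finally have "(\<lambda>N. exp (d N / \<nu> * w + c N * w\<^sup>2 * \<rho>\<^sup>2 * L (\<rho> * (w / s N)) + (1 - c N) * w\<^sup>2 * L (- 1 * (w / s N))))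
       \<longlonglongrightarrow> exp (w * (\<delta> / \<nu>) - w\<^sup>2 / 2 * \<rho>)" by (rule tendsto_exp)
    moreover have "eventually (\<lambda>N. exp (d N / \<nu> * w + c N * w\<^sup>2 * \<rho>\<^sup>2 * L (\<rho> * (w / s N)) + (1 - c N) * w\<^sup>2 * L (- 1 * (w / s N)))
       = g N (w / s N)) sequentially"
    proof -
      have "eventually (\<lambda>N. w < s N) sequentially" using s by (simp add: filterlim_at_top_dense)
      then show ?thesis using eventually_ge_at_top[of 1]
      proof eventually_elim
        case (elim N)
        define y where "y = w / s N"
        have sN: "s N > 0" using elim(1) w by linarith
        have y: "0 < y" "y < 1" "w = y * s N" using elim(1) sN w by (auto simp: y_def)
        have ln_L: "ln (1 + z) = z + z\<^sup>2 * L z" if "z \<noteq> 0" for z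
          using that by (simp add: L_def)
        have cs: "c N * (s N * s N) = real (C N)" "(1 - c N) * (s N * s N) = real (N - C N)"
          unfolding s2 using elim(2) C[OF elim(2)] by (auto simp: c_def of_nat_diff field_simps)
        have "g N y = exp (ln (1 + \<rho> * y)) ^ C N * exp (ln (1 + - y)) ^ (N - C N)"
          unfolding g_def using y \<rho> by (simp add: add_pos_pos)
        also have "\<dots> = exp (real (C N) * ln (1 + \<rho> * y) + real (N - C N) * ln (1 + - y))"
          unfolding exp_of_nat_mult[symmetric] exp_add ..
        also have "real (C N) * ln (1 + \<rho> * y) + real (N - C N) * ln (1 + - y) =
            (real (C N) * \<rho> - real (N - C N)) * y + real (C N) * (y\<^sup>2 * \<rho>\<^sup>2 * L (\<rho> * y)) + real (N - C N) * (y\<^sup>2 * L (- y))"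
          using y \<rho> by (subst (1 2) ln_L) (auto simp: algebra_simps power_mult_distrib)
        also have "\<dots> = d N / \<nu> * w + c N * w\<^sup>2 * \<rho>\<^sup>2 * L (\<rho> * y) + (1 - c N) * w\<^sup>2 * L (- 1 * y)"
          unfolding linear[OF elim(2) sN] unfolding cs[symmetric] y(3) by (simp add: power2_eq_square mult_ac)
        finally show ?case by (simp only: y_def)
      qed
    qed
    ultimately show ?thesis by (rule Lim_transform_eventually)
  qed
  have "(\<lambda>N. s N powr \<alpha> * (LINT u:{0<..<1}|lborel. g N u * u powr (\<alpha> - 1))) \<longlonglongrightarrow>
     (LINT w:{0<..}|lborel. exp (w * (\<delta> / \<nu>) - w\<^sup>2 / 2 * \<rho>) * w powr (\<alpha> - 1))"
  proof (rule mellin_dominated_convergence[OF s _ _ _ dom lim])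
    show "set_integrable lborel {0<..} (\<lambda>w. exp (w * A - w\<^sup>2 / 2 * (\<mu> / 2)) * w powr (\<alpha> - 1))"
      using \<alpha> par by (intro set_integrable_gauss_mellin) auto
    show "g N \<in> borel_measurable borel" for N unfolding g_def by measurable
  qed measurable
  then show ?thesis
    by (simp add: s_def g_def engset_eigenfunction_def gauss_mellin_def \<rho>_def)
qed

section \<open>The negative logarithm of a half-normal variable\<close>

lemma gauss_mellin_scaling:
  assumes s: "s > 0"
  shows "s powr \<alpha> * gauss_mellin a b \<alpha> = gauss_mellin (a / s) (b / s\<^sup>2) \<alpha>"
proof -
  have "gauss_mellin a b \<alpha> =
      (1 / s) * (LINT w|lborel. indicator {0<..} (w / s) * (exp (w / s * a - (w / s)\<^sup>2 / 2 * b) * (w / s) powr (\<alpha> - 1)))"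
    unfolding gauss_mellin_def set_lebesgue_integral_def using s
    by (subst lborel_integral_real_affine[where c = "1 / s" and t = 0]) auto
  also have "(\<lambda>w. indicator {0<..} (w / s) * (exp (w / s * a - (w / s)\<^sup>2 / 2 * b) * (w / s) powr (\<alpha> - 1))) =
      (\<lambda>w. (indicator {0<..} w * (exp (w * (a / s) - w\<^sup>2 / 2 * (b / s\<^sup>2)) * w powr (\<alpha> - 1))) * (s / s powr \<alpha>))"
  proof
    fix w :: real
    show "indicator {0<..} (w / s) * (exp (w / s * a - (w / s)\<^sup>2 / 2 * b) * (w / s) powr (\<alpha> - 1)) =
      (indicator {0<..} w * (exp (w * (a / s) - w\<^sup>2 / 2 * (b / s\<^sup>2)) * w powr (\<alpha> - 1))) * (s / s powr \<alpha>)"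
    proof (cases "0 < w")
      case True
      then have "(w / s) powr (\<alpha> - 1) = w powr (\<alpha> - 1) * (s / s powr \<alpha>)"
        using s by (simp add: powr_divide powr_diff)
      then show ?thesis using True s by (simp add: indicator_def power_divide)
    next
      case False
      then show ?thesis using s by (auto simp: indicator_def zero_less_divide_iff)
    qed
  qed
  also have "(LINT w|lborel. (indicator {0<..} w * (exp (w * (a / s) - w\<^sup>2 / 2 * (b / s\<^sup>2)) * w powr (\<alpha> - 1))) * (s / s powr \<alpha>)) =
      gauss_mellin (a / s) (b / s\<^sup>2) \<alpha> * (s / s powr \<alpha>)"
    unfolding gauss_mellin_def set_lebesgue_integral_def by (simp only: real_scaleR_def integral_mult_left_zero)
  finally show ?thesis using s by simp
qed

section \<open>Half-line Gaussian moments and duplication\<close>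

lemma gauss_mellin_0_2:
  "gauss_mellin 0 2 (real (2 * k + 1)) = sqrt pi / 2 * (fact (2 * k) / (2 ^ (2 * k) * fact k))"
  "gauss_mellin 0 2 (real (2 * k + 2)) = fact k / 2"
proof -
  have *: "gauss_mellin 0 2 (real (Suc j)) = (LINT x|lborel. indicator {0..} x *\<^sub>R (exp (- x\<^sup>2) * x ^ j))" for j
    unfolding gauss_mellin_def set_lebesgue_integral_def
  proof (rule integral_cong_AE)
    have "AE x in lborel. x \<noteq> (0::real)" by (rule AE_lborel_singleton)
    then show "AE x in lborel. indicator {0<..} x *\<^sub>R (exp (x * 0 - x\<^sup>2 / 2 * 2) * x powr (real (Suc j) - 1)) =
        indicator {0..} x *\<^sub>R (exp (- x\<^sup>2) * x ^ j)"
      by eventually_elim (auto simp: indicator_def powr_realpow)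
  qed measurable
  show "gauss_mellin 0 2 (real (2 * k + 1)) = sqrt pi / 2 * (fact (2 * k) / (2 ^ (2 * k) * fact k))"
    using *[of "2 * k"] has_bochner_integral_integral_eq[OF gaussian_moment_even_pos[of k]] by simp
  show "gauss_mellin 0 2 (real (2 * k + 2)) = fact k / 2"
    using *[of "2 * k + 1"] has_bochner_integral_integral_eq[OF gaussian_moment_odd_pos[of k]] by simp
qed

text \<open>Since the Mellin transform of exp (- u^2) at \<alpha> is Gamma (\<alpha> / 2) / 2, this
  is Legendre's duplication formula at (j + 1) / 2. It is checked by parity from the explicit even
  and odd moments.\<close>

lemma gauss_mellin_0_2_product:
  "gauss_mellin 0 2 (real (Suc j)) * gauss_mellin 0 2 (real (j + 2)) = sqrt pi / 4 * (fact j / 2 ^ j)"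
proof (cases "even j")
  case True
  then obtain k where j: "j = 2 * k" by (elim evenE)
  have 1: "Suc j = 2 * k + 1" "j + 2 = 2 * k + 2" by (auto simp: j)
  show ?thesis unfolding 1 gauss_mellin_0_2 unfolding j by simp
next
  case False
  then obtain k where j: "j = 2 * k + 1" by (elim oddE)
  have 1: "Suc j = 2 * k + 2" "j + 2 = 2 * Suc k + 1" by (auto simp: j)
  define r where "r = real (Suc k)"
  have r: "r \<noteq> 0" by (simp add: r_def)
  have f: "fact (2 * Suc k) = 2 * r * fact j" unfolding j r_def by (simp add: algebra_simps)
  have p: "(2::real) ^ (2 * Suc k) = 2 * 2 ^ j" unfolding j by simp
  have q: "fact (Suc k) = r * fact k" by (simp add: r_def)
  have "fact (2 * Suc k) / (2 ^ (2 * Suc k) * fact (Suc k)) = fact j / (2 ^ j * fact k :: real)"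
    unfolding f p q using r by simp
  then show ?thesis unfolding 1 gauss_mellin_0_2 by (simp only:) simp
qed

text \<open>In this form duplication says that Gamma k divided by the transform at k is sqrt (2 /
  pi) times the transform at k + 1, that is, the k-th absolute moment of a standard normal
  variable.\<close>

lemma gauss_mellin_0_1_product:
  "gauss_mellin 0 1 (real (Suc j)) * gauss_mellin 0 1 (real (j + 2)) = sqrt (pi / 2) * fact j"
proof -
  have sc: "gauss_mellin 0 1 (real (Suc i)) = sqrt 2 * sqrt 2 ^ i * gauss_mellin 0 2 (real (Suc i))" for i
    using gauss_mellin_scaling[of "sqrt 2" "real (Suc i)" 0 2] powr_realpow[of "sqrt 2" "Suc i"] by simp
  have sq: "sqrt 2 ^ j * sqrt 2 ^ j = 2 ^ j" by (simp flip: power_mult_distrib)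
  have "gauss_mellin 0 1 (real (Suc j)) * gauss_mellin 0 1 (real (Suc (Suc j))) =
     (sqrt 2 * sqrt 2) * sqrt 2 * (sqrt 2 ^ j * sqrt 2 ^ j) * (gauss_mellin 0 2 (real (Suc j)) * gauss_mellin 0 2 (real (j + 2)))"
    unfolding sc by simp
  also have "\<dots> = sqrt 2 / 2 * sqrt pi * fact j"
    unfolding sq gauss_mellin_0_2_product by simp
  also have "sqrt 2 / 2 * sqrt pi = sqrt (pi / 2)" by (simp add: real_sqrt_divide field_simps)
  finally show ?thesis by simp
qed

lemma gauss_mellin_0_1_1: "gauss_mellin 0 1 1 = sqrt (pi / 2)"
proof -
  have "gauss_mellin 0 1 1 = sqrt 2 * gauss_mellin 0 2 (real (2 * 0 + 1))"
    using gauss_mellin_scaling[of "sqrt 2" 1 0 2] by simp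
  also have "\<dots> = sqrt (pi / 2)"
    unfolding gauss_mellin_0_2 by (simp add: real_sqrt_divide field_simps)
  finally show ?thesis .
qed

definition neg_log_half_normal_density :: "real \<Rightarrow> real" where
  "neg_log_half_normal_density x = sqrt (2 / pi) * exp (- x - exp (- 2 * x) / 2)"

lemma borel_measurable_neg_log_half_normal_density [measurable]:
  "neg_log_half_normal_density \<in> borel_measurable borel"
  unfolding neg_log_half_normal_density_def by measurable

text \<open>Substitute \<open>w = exp (- x)\<close>.\<close>

lemma neg_log_half_normal_laplace:
  assumes "\<alpha> \<ge> 0"
  shows "has_bochner_integral lborel (\<lambda>x. neg_log_half_normal_density x * exp (- \<alpha> * x))
     (sqrt (2 / pi) * gauss_mellin 0 1 (\<alpha> + 1))"
proof -
  define f where "f w = exp (w * 0 - w\<^sup>2 / 2 * 1) * w powr (\<alpha> + 1 - 1)" for w :: real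
  have fint: "set_integrable lborel {0<..} f"
    unfolding f_def using assms by (intro set_integrable_gauss_mellin) auto
  have img: "range (\<lambda>x::real. exp (- x)) = {0<..}"
  proof (intro equalityI subsetI)
    fix w :: real assume "w \<in> {0<..}"
    then have "w = exp (- (- ln w))" by simp
    then show "w \<in> range (\<lambda>x. exp (- x))" by (rule range_eqI)
  qed auto
  have "f absolutely_integrable_on {0<..}"
    using fint unfolding set_integrable_def by (subst integrable_completion) (auto simp: f_def)
  moreover have "integral {0<..} f = gauss_mellin 0 1 (\<alpha> + 1)"
    using set_borel_integral_eq_integral(2)[OF fint] by (simp add: gauss_mellin_def f_def)
  ultimately have "(\<lambda>x. \<bar>- exp (- x)\<bar> * f (exp (- x))) absolutely_integrable_on UNIV \<and>
      integral UNIV (\<lambda>x. \<bar>- exp (- x)\<bar> * f (exp (- x))) = gauss_mellin 0 1 (\<alpha> + 1)"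
    by (subst has_absolute_integral_change_of_variables_1') (auto simp: img inj_on_def intro!: derivative_eq_intros)
  moreover have "\<bar>- exp (- x)\<bar> * f (exp (- x)) = sqrt (pi / 2) * (neg_log_half_normal_density x * exp (- \<alpha> * x))" for x
  proof -
    have "f (exp (- x)) = exp (- (exp (- 2 * x) / 2)) * exp (- \<alpha> * x)"
      by (simp add: f_def powr_def exp_double[symmetric] flip: exp_of_nat_mult exp_add)
    moreover have "sqrt (pi / 2) * sqrt (2 / pi) = 1" by (simp flip: real_sqrt_mult)
    moreover have e: "exp (- x - exp (- 2 * x) / 2) = exp (- x) * exp (- (exp (- 2 * x) / 2))"
      by (simp flip: exp_add)
    moreover have "sqrt (pi / 2) * (sqrt (2 / pi) * (exp (- x) * exp (- (exp (- 2 * x) / 2))) * exp (- \<alpha> * x)) =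
        (sqrt (pi / 2) * sqrt (2 / pi)) * (exp (- x) * (exp (- (exp (- 2 * x) / 2)) * exp (- \<alpha> * x)))"
      by (simp only: mult_ac)
    ultimately show ?thesis
      unfolding neg_log_half_normal_density_def by (simp only: abs_minus_cancel abs_exp_cancel mult_1)
  qed
  ultimately have *: "(\<lambda>x. sqrt (pi / 2) * (neg_log_half_normal_density x * exp (- \<alpha> * x))) absolutely_integrable_on UNIV"
      "integral UNIV (\<lambda>x. sqrt (pi / 2) * (neg_log_half_normal_density x * exp (- \<alpha> * x))) = gauss_mellin 0 1 (\<alpha> + 1)"
    by simp_all
  have int: "integrable lborel (\<lambda>x. sqrt (pi / 2) * (neg_log_half_normal_density x * exp (- \<alpha> * x)))"
    using *(1) unfolding set_integrable_def by (subst (asm) integrable_completion) auto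
  have "(LINT x|lborel. sqrt (pi / 2) * (neg_log_half_normal_density x * exp (- \<alpha> * x))) = gauss_mellin 0 1 (\<alpha> + 1)"
    using *(2) integral_lborel[OF int] by simp
  then have "sqrt (pi / 2) * (LINT x|lborel. neg_log_half_normal_density x * exp (- \<alpha> * x)) = gauss_mellin 0 1 (\<alpha> + 1)"
    unfolding integral_mult_right_zero .
  then have "(LINT x|lborel. neg_log_half_normal_density x * exp (- \<alpha> * x)) = gauss_mellin 0 1 (\<alpha> + 1) / sqrt (pi / 2)"
    by (metis (no_types) nonzero_mult_div_cancel_left pi_neq_zero divide_eq_0_iff real_sqrt_eq_zero_cancel_iff zero_neq_numeral)
  also have "\<dots> = sqrt (2 / pi) * gauss_mellin 0 1 (\<alpha> + 1)" by (simp add: real_sqrt_divide)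
  finally show ?thesis using int by (simp add: has_bochner_integral_iff)
qed

lemma real_distribution_neg_log_half_normal:
  "real_distribution (density lborel (\<lambda>x. ennreal (neg_log_half_normal_density x)))"
proof -
  have "has_bochner_integral lborel neg_log_half_normal_density 1"
    using neg_log_half_normal_laplace[of 0] by (simp add: gauss_mellin_0_1_1 real_sqrt_divide)
  then have "(\<integral>\<^sup>+ x. ennreal (neg_log_half_normal_density x) \<partial>lborel) = ennreal 1"
    by (subst nn_integral_eq_integral) (auto simp: has_bochner_integral_iff neg_log_half_normal_density_def)
  then have "prob_space (density lborel (\<lambda>x. ennreal (neg_log_half_normal_density x)))"
    by (intro prob_spaceI) (simp add: emeasure_density)
  then show ?thesis by (simp add: real_distribution_def real_distribution_axioms_def)
qed

text \<open>The product formula turns the moment sqrt (2 / pi) times the Mellin transform at k + 1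
  into the quotient occurring in the limit. Integers are enough, since uniqueness only compares
  transforms there.\<close>

lemma neg_log_half_normal_laplace_nat:
  assumes k: "k \<ge> 1" and M: "M = density lborel (\<lambda>x. ennreal (neg_log_half_normal_density x))"
  shows "integrable M (\<lambda>x. exp (- real k * x))"
    and "(LINT x|M. exp (- real k * x)) = Gamma (real k) / gauss_mellin 0 1 (real k)"
proof -
  have nn: "neg_log_half_normal_density x \<ge> 0" for x by (simp add: neg_log_half_normal_density_def)
  from neg_log_half_normal_laplace[of "real k"]
  have b: "integrable lborel (\<lambda>x. neg_log_half_normal_density x * exp (- real k * x))"
    "(LINT x|lborel. neg_log_half_normal_density x * exp (- real k * x)) = sqrt (2 / pi) * gauss_mellin 0 1 (real k + 1)"
    by (auto simp: has_bochner_integral_iff)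
  show "integrable M (\<lambda>x. exp (- real k * x))"
    unfolding M using nn b(1) by (subst integrable_density) auto
  obtain j where j: "k = Suc j" using k by (cases k) auto
  have pos: "gauss_mellin 0 1 (real k) > 0" using k by (intro gauss_mellin_pos) auto
  have "gauss_mellin 0 1 (real k) * gauss_mellin 0 1 (real k + 1) = sqrt (pi / 2) * Gamma (real k)"
    using gauss_mellin_0_1_product[of j] Gamma_fact[of j, where 'a = real] by (simp add: j add_ac)
  moreover have "sqrt (2 / pi) * sqrt (pi / 2) = 1" by (simp flip: real_sqrt_mult)
  ultimately have "gauss_mellin 0 1 (real k) * (sqrt (2 / pi) * gauss_mellin 0 1 (real k + 1)) = Gamma (real k)"
    by (metis (no_types, opaque_lifting) mult.assoc mult.commute mult.right_neutral)
  then have "sqrt (2 / pi) * gauss_mellin 0 1 (real k + 1) = Gamma (real k) / gauss_mellin 0 1 (real k)"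
    using pos by (simp add: field_simps)
  then show "(LINT x|M. exp (- real k * x)) = Gamma (real k) / gauss_mellin 0 1 (real k)"
    unfolding M using nn b(2) by (subst integral_density) auto
qed

section \<open>Hitting times of the Engset process\<close>

locale engset_at_0 =
  fixes M :: "'a measure" and N C :: nat and \<nu> \<mu> :: real and X :: "real \<Rightarrow> 'a \<Rightarrow> nat"
  assumes par: "\<mu> > 0" "\<nu> > 0" "\<mu> + \<nu> = 1" and C: "C \<le> N"
    and process: "engset_process M N C \<nu> \<mu> X" and start: "AE \<omega> in M. X 0 \<omega> = 0"
begin

abbreviation "T \<equiv> hitting_time X C"

sublocale prob_space M
  using process by (simp add: engset_process_def markov_jump_process_def)

lemma borel_measurable_T [measurable]: "T \<in> borel_measurable M"
  using process unfolding engset_process_def markov_jump_process_def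
  by (intro borel_measurable_hitting_time) auto

lemma T_nonneg: "T \<omega> \<ge> 0"
  unfolding hitting_time_def by (intro INF_greatest) auto

lemma laplace_T:
  assumes \<alpha>: "\<alpha> > 0"
  shows "(LINT \<omega>|M. (if T \<omega> < \<infinity> then exp (- \<alpha> * real_of_ereal (T \<omega>)) else 0)) =
     engset_eigenfunction N (\<mu> / \<nu>) \<alpha> 0 / engset_eigenfunction N (\<mu> / \<nu>) \<alpha> C"
proof -
  let ?f = "engset_eigenfunction N (\<mu> / \<nu>) \<alpha>"
  have "(LINT \<omega>|M. (if T \<omega> < \<infinity> then exp (- \<alpha> * real_of_ereal (T \<omega>)) else 0)) * ?f C = (LINT \<omega>|M. ?f (X 0 \<omega>))"
    using process unfolding engset_process_def
    by (rule laplace_hitting_time_eigenvector) (auto intro!: \<alpha> engset_rate_eigenvector[OF \<alpha> par C])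
  also have "\<dots> = (LINT \<omega>|M. ?f 0)"
  proof (rule integral_cong_AE)
    have [measurable]: "X 0 \<in> measurable M (count_space UNIV)"
      using process by (simp add: engset_process_def markov_jump_process_def)
    show "(\<lambda>\<omega>. ?f (X 0 \<omega>)) \<in> borel_measurable M" by measurable
    show "AE \<omega> in M. ?f (X 0 \<omega>) = ?f 0" using start by eventually_elim simp
  qed simp
  also have "\<dots> = ?f 0" using prob_space by simp
  finally show ?thesis
    using engset_eigenfunction_pos[OF \<alpha>, of "\<mu> / \<nu>" N C] par by (simp add: eq_divide_eq)
qed

text \<open>Letting \<open>\<alpha>\<close> tend to \<open>0\<close> in the transform of \<open>T\<close> shows that no mass escapes to infinity.\<close>

lemma T_finite: "AE \<omega> in M. T \<omega> < \<infinity>"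
proof -
  let ?f = "\<lambda>\<alpha>. engset_eigenfunction N (\<mu> / \<nu>) \<alpha>"
  have S: "{\<omega> \<in> space M. T \<omega> < \<infinity>} \<in> sets M" by measurable
  have "1 \<le> prob {\<omega> \<in> space M. T \<omega> < \<infinity>}"
  proof (rule tendsto_upperbound)
    have "((\<lambda>\<alpha>. inverse (?f \<alpha> C / ?f \<alpha> 0)) \<longlongrightarrow> inverse 1) (at_right 0)"
      by (intro tendsto_inverse engset_eigenfunction_ratio_at_0 par C) simp
    then show "((\<lambda>\<alpha>. ?f \<alpha> 0 / ?f \<alpha> C) \<longlongrightarrow> 1) (at_right 0)" by simp
    have "eventually (\<lambda>\<alpha>::real. \<alpha> > 0) (at_right 0)" by (rule eventually_at_right_less)
    then show "eventually (\<lambda>\<alpha>. ?f \<alpha> 0 / ?f \<alpha> C \<le> prob {\<omega> \<in> space M. T \<omega> < \<infinity>}) (at_right 0)"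
    proof eventually_elim
      case (elim \<alpha>)
      have "?f \<alpha> 0 / ?f \<alpha> C \<le> (LINT \<omega>|M. indicator {\<omega> \<in> space M. T \<omega> < \<infinity>} \<omega>)"
        unfolding laplace_T[OF elim, symmetric]
      proof (rule integral_mono)
        show "integrable M (\<lambda>\<omega>. if T \<omega> < \<infinity> then exp (- \<alpha> * real_of_ereal (T \<omega>)) else 0)"
          using elim T_nonneg by (intro integrable_const_bound[where B = 1]) (auto simp: real_of_ereal_pos)
        show "integrable M (\<lambda>\<omega>. indicator {\<omega> \<in> space M. T \<omega> < \<infinity>} \<omega> :: real)"
          using S by (intro integrable_const_bound[where B = 1]) (auto simp: indicator_def)
      qed (use elim T_nonneg in \<open>auto simp: real_of_ereal_pos\<close>)
      then show ?case using S by simp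
    qed
  qed simp
  then have "prob {\<omega> \<in> space M. T \<omega> < \<infinity>} = 1" using prob_le_1 by (intro antisym) auto
  then show ?thesis using prob_Collect_eq_1[OF S] by simp
qed

lemma real_distribution_centred_T:
  "real_distribution (distr M borel (\<lambda>\<omega>. real_of_ereal (T \<omega>) - c))"
  by (intro real_distribution_distr) measurable

lemma laplace_centred_T:
  fixes c :: real
  assumes \<alpha>: "\<alpha> > 0"
  defines "D \<equiv> distr M borel (\<lambda>\<omega>. real_of_ereal (T \<omega>) - c)"
  shows "integrable D (\<lambda>x. exp (- \<alpha> * x))"
    and "(LINT x|D. exp (- \<alpha> * x)) =
      exp (\<alpha> * c) * (engset_eigenfunction N (\<mu> / \<nu>) \<alpha> 0 / engset_eigenfunction N (\<mu> / \<nu>) \<alpha> C)"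
proof -
  have eq: "exp (- \<alpha> * (t - c)) = exp (\<alpha> * c) * exp (- \<alpha> * t)" for t
    by (simp add: algebra_simps flip: exp_add)
  have "integrable M (\<lambda>\<omega>. exp (- \<alpha> * real_of_ereal (T \<omega>)))"
    using \<alpha> T_nonneg by (intro integrable_const_bound[where B = 1]) (auto simp: real_of_ereal_pos)
  then have "integrable M (\<lambda>\<omega>. exp (- \<alpha> * (real_of_ereal (T \<omega>) - c)))"
    unfolding eq by (rule integrable_mult_right)
  then show "integrable D (\<lambda>x. exp (- \<alpha> * x))"
    unfolding D_def by (subst integrable_distr_eq) simp_all
  have "(LINT x|D. exp (- \<alpha> * x)) = exp (\<alpha> * c) * (LINT \<omega>|M. exp (- \<alpha> * real_of_ereal (T \<omega>)))"
    unfolding D_def by (subst integral_distr) (simp_all only: eq integral_mult_right_zero, measurable)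
  also have "(LINT \<omega>|M. exp (- \<alpha> * real_of_ereal (T \<omega>))) =
      (LINT \<omega>|M. (if T \<omega> < \<infinity> then exp (- \<alpha> * real_of_ereal (T \<omega>)) else 0))"
  proof (rule integral_cong_AE)
    \<comment> \<open>Almost sure finiteness is what allows the case distinction to be dropped: on
      an infinite hitting time the left side would be 1 and the right side 0.\<close>
    show "AE \<omega> in M. exp (- \<alpha> * real_of_ereal (T \<omega>)) = (if T \<omega> < \<infinity> then exp (- \<alpha> * real_of_ereal (T \<omega>)) else 0)"
      using T_finite by eventually_elim simp
  qed measurable
  finally show "(LINT x|D. exp (- \<alpha> * x)) =
      exp (\<alpha> * c) * (engset_eigenfunction N (\<mu> / \<nu>) \<alpha> 0 / engset_eigenfunction N (\<mu> / \<nu>) \<alpha> C)"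
    unfolding laplace_T[OF \<alpha>] .
qed

end

text \<open>Subtracting ln (1 / \<rho>) / 2 multiplies the transform at \<alpha> by \<rho> to the
  power - \<alpha> / 2, which is exactly the factor by which rescaling changes the Gaussian weight
  from parameter \<rho> to parameter 1.\<close>

lemma distributed_neg_log_half_normal:
  assumes M: "real_distribution M" and \<rho>: "\<rho> > 0"
    and int: "\<And>\<alpha>. \<alpha> > 0 \<Longrightarrow> integrable M (\<lambda>x. exp (- \<alpha> * x))"
    and transform: "\<And>\<alpha>. \<alpha> > 0 \<Longrightarrow> (LINT x|M. exp (- \<alpha> * x)) = Gamma \<alpha> / gauss_mellin 0 \<rho> \<alpha>"
  shows "distributed M lborel (\<lambda>x. x - 1 / 2 * ln (1 / \<rho>)) (\<lambda>x. ennreal (neg_log_half_normal_density x))"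
proof -
  interpret M: real_distribution M by fact
  define c where "c = 1 / 2 * ln (1 / \<rho>)"
  define M1 where "M1 = distr M borel (\<lambda>x. x - c)"
  define M2 where "M2 = density lborel (\<lambda>x. ennreal (neg_log_half_normal_density x))"
  have eq: "exp (- \<alpha> * (x - c)) = exp (\<alpha> * c) * exp (- \<alpha> * x)" for \<alpha> x
    by (simp add: algebra_simps flip: exp_add)
  have "M1 = M2"
  proof (rule laplace_transform_determines_distribution)
    show "real_distribution M1" unfolding M1_def by (intro M.real_distribution_distr) measurable
    show "real_distribution M2" unfolding M2_def by (rule real_distribution_neg_log_half_normal)
    fix k :: nat assume k: "k \<ge> 1"
    show "integrable M2 (\<lambda>x. exp (- real k * x))"
      "(LINT x|M2. exp (- real k * x)) = Gamma (real k) / gauss_mellin 0 1 (real k)"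
      by (rule neg_log_half_normal_laplace_nat[OF k M2_def])+
    have "integrable M (\<lambda>x. exp (- real k * (x - c)))"
      unfolding eq using int[of "real k"] k by (intro integrable_mult_right) simp
    then show "integrable M1 (\<lambda>x. exp (- real k * x))"
      unfolding M1_def by (subst integrable_distr_eq) simp_all
    have c: "exp (real k * c) * sqrt \<rho> powr real k = 1"
    proof -
      have "sqrt \<rho> powr real k = exp (real k * (ln \<rho> / 2))"
        using \<rho> by (simp add: powr_def ln_sqrt)
      moreover have "c = - (ln \<rho> / 2)" using \<rho> by (simp add: c_def ln_div)
      ultimately show ?thesis by (simp flip: exp_add)
    qed
    have sc: "sqrt \<rho> powr real k * gauss_mellin 0 \<rho> (real k) = gauss_mellin 0 1 (real k)"
      using gauss_mellin_scaling[of "sqrt \<rho>" "real k" 0 \<rho>] \<rho> by simp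
    have "(LINT x|M1. exp (- real k * x)) = exp (real k * c) * (LINT x|M. exp (- real k * x))"
      unfolding M1_def by (subst integral_distr) (simp_all only: eq integral_mult_right_zero, measurable)
    also have "\<dots> = exp (real k * c) * (Gamma (real k) / gauss_mellin 0 \<rho> (real k))"
      using transform[of "real k"] k by simp
    also have "\<dots> = Gamma (real k) / gauss_mellin 0 1 (real k)"
      unfolding sc[symmetric] using c gauss_mellin_pos[of "real k" \<rho> 0] k \<rho> by (simp add: field_simps)
    finally show "(LINT x|M1. exp (- real k * x)) = Gamma (real k) / gauss_mellin 0 1 (real k)" .
  qed (rule Gamma_over_gauss_mellin_growth, auto)
  moreover have "distr M lborel (\<lambda>x. x - c) = M1"
    unfolding M1_def by (rule distr_cong) auto
  ultimately show ?thesis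
    unfolding distributed_def M2_def c_def by auto
qed

theorem proposition10:
  fixes \<mu> \<nu> \<delta> :: real
    and C :: "nat \<Rightarrow> nat"
    and M :: "nat \<Rightarrow> 'a measure"
    and X :: "nat \<Rightarrow> real \<Rightarrow> 'a \<Rightarrow> nat"
  assumes "\<mu> > 0" "\<nu> > 0" "\<mu> + \<nu> = 1"
    and "\<And>N. N \<ge> 1 \<Longrightarrow> 1 \<le> C N \<and> C N \<le> N"
    and "\<And>N. N \<ge> 1 \<Longrightarrow> engset_process (M N) N (C N) \<nu> \<mu> (X N)"
    and "\<And>N. N \<ge> 1 \<Longrightarrow> AE \<omega> in M N. X N 0 \<omega> = 0"
    and "(\<lambda>N. real (C N) - (\<nu> * real N + \<delta> * sqrt (real N))) \<in> o(\<lambda>N. sqrt (real N))"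
  shows "(\<forall>N\<ge>1. hitting_time (X N) (C N) \<in> borel_measurable (M N) \<and>
                 (AE \<omega> in M N. hitting_time (X N) (C N) \<omega> < \<infinity>)) \<and>
         (\<exists>(\<Omega> :: real measure) (Z :: real \<Rightarrow> real).
            prob_space \<Omega> \<and> Z \<in> borel_measurable \<Omega> \<and>
            weak_conv_m
              (\<lambda>N. distr (M N) borel
                 (\<lambda>\<omega>. real_of_ereal (hitting_time (X N) (C N) \<omega>) - ln (real N) / 2))
              (distr \<Omega> borel Z) \<and>
            (\<forall>\<alpha>>0. integrable \<Omega> (\<lambda>\<omega>. exp (- \<alpha> * Z \<omega>)) \<and>
               (LINT \<omega>|\<Omega>. exp (- \<alpha> * Z \<omega>)) =
                 Gamma \<alpha> /
                 (LINT u:{0<..}|lborel.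
                    exp (u * (\<delta> / \<nu>) - u\<^sup>2 / 2 * ((1 - \<nu>) / \<nu>)) * u powr (\<alpha> - 1))) \<and>
            (\<delta> = 0 \<longrightarrow>
               distributed \<Omega> lborel (\<lambda>\<omega>. Z \<omega> - 1 / 2 * ln (\<nu> / (1 - \<nu>)))
                 (\<lambda>x. ennreal (sqrt (2 / pi) * exp (- x - exp (- 2 * x) / 2)))))"
proof -
  let ?T = "\<lambda>N. hitting_time (X N) (C N)"
  let ?D = "\<lambda>N. distr (M N) borel (\<lambda>\<omega>. real_of_ereal (?T N \<omega>) - ln (real N) / 2)"
  define \<phi> where "\<phi> \<alpha> = Gamma \<alpha> / gauss_mellin (\<delta> / \<nu>) (\<mu> / \<nu>) \<alpha>" for \<alpha>
  have \<rho>: "\<mu> / \<nu> > 0" "(1 - \<nu>) / \<nu> = \<mu> / \<nu>" "\<nu> / (1 - \<nu>) = 1 / (\<mu> / \<nu>)"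
    using assms(1-3) by auto
  have loc: "engset_at_0 (M N) N (C N) \<nu> \<mu> (X N)" if "N \<ge> 1" for N
    using assms that by unfold_locales auto
  \<comment> \<open>The index is shifted because the hypotheses say nothing about N = 0, where
    \<open>M 0\<close> need not even be a probability space.\<close>
  have lim: "(\<lambda>n. LINT x|?D (Suc n). exp (- \<alpha> * x)) \<longlonglongrightarrow> \<phi> \<alpha>" if \<alpha>: "\<alpha> > 0" for \<alpha>
  proof -
    let ?f = "\<lambda>N. engset_eigenfunction N (\<mu> / \<nu>) \<alpha>"
    have "(\<lambda>N. (real N powr \<alpha> * ?f N 0) / (sqrt (real N) powr \<alpha> * ?f N (C N))) \<longlonglongrightarrow> \<phi> \<alpha>"
      unfolding \<phi>_def
    proof (intro tendsto_divide engset_eigenfunction_0_asymptotics[OF \<alpha>])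
      show "(\<lambda>N. sqrt (real N) powr \<alpha> * ?f N (C N)) \<longlonglongrightarrow> gauss_mellin (\<delta> / \<nu>) (\<mu> / \<nu>) \<alpha>"
        using assms by (intro engset_eigenfunction_critical_asymptotics \<alpha>) auto
      show "gauss_mellin (\<delta> / \<nu>) (\<mu> / \<nu>) \<alpha> \<noteq> 0" using gauss_mellin_pos[OF \<alpha> \<rho>(1)] by (metis less_irrefl)
    qed
    then have lim': "(\<lambda>n. (real (Suc n) powr \<alpha> * ?f (Suc n) 0) / (sqrt (real (Suc n)) powr \<alpha> * ?f (Suc n) (C (Suc n)))) \<longlonglongrightarrow> \<phi> \<alpha>"
      by (rule LIMSEQ_Suc)
    \<comment> \<open>The two scales N and sqrt N leave the factor N^(\<alpha> / 2) = exp (\<alpha>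
      ln N / 2), which is the effect of the centring by ln N / 2.\<close>
    have eqN: "(real N powr \<alpha> * ?f N 0) / (sqrt (real N) powr \<alpha> * ?f N (C N)) = (LINT x|?D N. exp (- \<alpha> * x))"
      if "N \<ge> 1" for N
    proof -
      have "sqrt (real N) powr \<alpha> = exp (\<alpha> * (ln (real N) / 2))"
        using that by (simp add: powr_def ln_sqrt)
      moreover have "real N powr \<alpha> = exp (\<alpha> * (ln (real N) / 2)) * exp (\<alpha> * (ln (real N) / 2))"
        using that by (simp add: powr_def flip: exp_add)
      ultimately show ?thesis
        unfolding engset_at_0.laplace_centred_T(2)[OF loc[OF that] \<alpha>] by simp
    qed
    show ?thesis
      by (rule Lim_transform_eventually[OF lim' always_eventually]) (intro allI eqN, simp)
  qed
  obtain L where L: "real_distribution L" "weak_conv_m (\<lambda>n. ?D (Suc n)) L"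
    "\<And>\<alpha>. \<alpha> > 0 \<Longrightarrow> integrable L (\<lambda>x. exp (- \<alpha> * x)) \<and> (LINT x|L. exp (- \<alpha> * x)) = \<phi> \<alpha>"
  proof (rule laplace_continuity[where \<mu> = "\<lambda>n. ?D (Suc n)" and \<phi> = \<phi>])
    show "real_distribution (?D (Suc n))" for n
      by (rule engset_at_0.real_distribution_centred_T[OF loc]) simp
    show "integrable (?D (Suc n)) (\<lambda>x. exp (- \<alpha> * x))" if "\<alpha> > 0" for n \<alpha>
      by (rule engset_at_0.laplace_centred_T(1)[OF loc that]) simp
    show "(\<phi> \<longlongrightarrow> 1) (at_right 0)"
      unfolding \<phi>_def by (rule Gamma_over_gauss_mellin_at_0[OF \<rho>(1)])
    show "(\<lambda>k. t ^ k * \<phi> (real k) / fact k) \<longlonglongrightarrow> 0" if "t > 0" for t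
      unfolding \<phi>_def by (rule Gamma_over_gauss_mellin_growth[OF \<rho>(1) that])
  qed (use lim in auto)
  interpret L: real_distribution L by (rule L)
  \<comment> \<open>The limit law itself serves as the probability space, with the identity as Z;
    the single index 0 does not affect the limit.\<close>
  have "weak_conv_m ?D (distr L borel (\<lambda>x. x))"
  proof -
    have "distr L borel (\<lambda>x. x) = L" by (rule distr_id2) simp
    then show ?thesis using L(2) unfolding weak_conv_m_def weak_conv_def by (simp add: LIMSEQ_imp_Suc)
  qed
  moreover have "(LINT u:{0<..}|lborel. exp (u * (\<delta> / \<nu>) - u\<^sup>2 / 2 * ((1 - \<nu>) / \<nu>)) * u powr (\<alpha> - 1)) =
      gauss_mellin (\<delta> / \<nu>) (\<mu> / \<nu>) \<alpha>" for \<alpha>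
    unfolding gauss_mellin_def \<rho>(2) ..
  moreover have "distributed L lborel (\<lambda>x. x - 1 / 2 * ln (\<nu> / (1 - \<nu>)))
      (\<lambda>x. ennreal (sqrt (2 / pi) * exp (- x - exp (- 2 * x) / 2)))" if "\<delta> = 0"
    using distributed_neg_log_half_normal[OF L(1) \<rho>(1)] L(3) that
    unfolding \<rho>(3) neg_log_half_normal_density_def \<phi>_def by simp
  moreover have "?T N \<in> borel_measurable (M N)" "AE \<omega> in M N. ?T N \<omega> < \<infinity>" if "N \<ge> 1" for N
    using engset_at_0.borel_measurable_T[OF loc[OF that]] engset_at_0.T_finite[OF loc[OF that]] by auto
  ultimately show ?thesis
    using L(3) L.prob_space_axioms unfolding \<phi>_def
    by (intro conjI exI[of _ L] exI[of _ "\<lambda>x. x"]) auto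
qed

end
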